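(* Let $m\ge2$ be an integer. Let $(\xi_t)_{t\ge0}$ be the embedding birth process defined by the sequence $\lambda_k=1$ for every $k\in\mathbb{N}$, and let $(\mathrm{CBP}^{(m)}_t)_{t\ge0}$ be the corresponding collapsed branching process. Then the sequence of random graphs $(\mathrm{CBP}^{(m)}_{\tau_{(n,j)}})$ has transition probabilities $$\mathbb{P}\left(n\stackrel{j+1}{\rightarrow}i\ \middle|\ \mathrm{CBP}^{(m)}_{\tau_{(n,j)}}\right)=\begin{cases}\dfrac{1}{(n-1)+j/m}&\text{if } i\ne n,\\[2mm] \dfrac{j/m}{(n-1)+j/m}&\text{if } i=n,\end{cases}$$ for $0\le j\le m-1$ with $(n,j)\ge1$ and $1\le i\le n$. As a consequence, the limiting degree distribution is $$p^{(m)}_k=\frac{1}{m+1}\left(1+\frac1m\right)^{-k},\qquad k\in\mathbb{N},$$ that is, for every $k\in\mathbb{N}$, as $t\to\infty$, $N^{(m)}_k(t)/N^{(m)}(t)\to p^{(m)}_k$ in probability, where $N^{(m)}(t)$ is the number of vertices of $\mathrm{CBP}^{(m)}_t$ and $N^{(m)}_k(t)$ is the number of its vertices with (in-)degree $k$. The same result also holds in discrete time: for every $k\in\mathbb{N}$ and $j\in\{1,\dots,m\}$, the fraction of vertices with (in-)degree $k$ in $\mathrm{CBP}^{(m)}_{\tau_{(n,j)}}$ converges in probability to $p^{(m)}_k$ as $n\to\infty$.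
   Context: Degrees $k$ range over $\mathbb{N}=\{0,1,2,\dots\}$; individuals and vertices are numbered from $1$. Embedding birth process defined by positive numbers $(\lambda_k)_{k\in\mathbb{N}}$: let $(E_k)_{k\in\mathbb{N}}$ be independent, $E_k$ exponential with parameter $\lambda_k$, $E_{-1}=0$; then $\xi_t=k$ if $t\in[E_{-1}+\cdots+E_{k-1},\,E_{-1}+\cdots+E_k)$; set $\xi_t=0$ for $t<0$. Continuous-time branching process defined by $\xi$: it starts with one individual born at time $0$; each individual $x$, born at time $\tau_x$, carries an i.i.d. copy $\xi^x$ of $\xi$ and gives birth to a child at time $\tau_x+s$ for each jump time $s$ of $\xi^x$; individuals never die. Individuals are labelled $1,2,\ldots$ in order of birth, with birth times $\tau_1\le\tau_2\le\cdots$. The associated tree has a directed edge from each individual other than the first to its parent. Collapsed branching process: write $(n,j)=m(n-1)+j$ (so $(n,0)=(n-1,m)$). $\mathrm{CBP}^{(m)}_t$ is the directed multigraph whose vertex $n$ is obtained by merging individuals $(n,1),\ldots,(n,m)$; vertex $n$ is present at time $t$ when $\tau_{(n,1)}\le t$; the number of directed edges from vertex $x$ to vertex $y$ is the number of $j\in\{1,\dots,m\}$ such that $\tau_{(x,j)}\le t$ and the parent of individual $(x,j)$ is one of $(y,1),\ldots,(y,m)$. The event $n\stackrel{j+1}{\rightarrow}i$ is that the edge created by the birth of individual $(n,j+1)$ goes from vertex $n$ to vertex $i$, i.e. the parent of individual $(n,j+1)$ is one of $(i,1),\ldots,(i,m)$. The (in-)degree of vertex $n$ at time $t$ is $D^{(\mathrm{in})}_n(t)=\sum_{j=1}^m\xi^{(n,j)}_{t-\tau_{(n,j)}}$.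 The sequence of random graphs in which, for $0\le j\le m-1$ with $(n,j)\ge1$ and $1\le i\le n$, the conditional probability of the event $n\stackrel{j+1}{\rightarrow}i$ given $\mathrm{CBP}^{(m)}_{\tau_{(n,j)}}$ equals $\frac{1}{(n-1)+j/m}$ if $i\ne n$ and $\frac{j/m}{(n-1)+j/m}$ if $i=n$ is called the random recursive graph. *)

theory Defs
  imports "HOL-Probability.Probability"
begin

text \<open>
  The embedding birth process with holding times \<open>h 0, h 1, \<dots>\<close>.  For positive \<open>h\<close> and
  \<open>0 \<le> t < (\<Sum>i. h i)\<close> the \<open>k\<close> below is unique.
\<close>

definition birth_process :: "(nat \<Rightarrow> real) \<Rightarrow> real \<Rightarrow> nat" where
  "birth_process h t =
     (if t < 0 then 0 else (LEAST k. t \<in> {(\<Sum>i<k. h i) ..< (\<Sum>i\<le>k. h i)}))"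

text \<open>
  Individuals are identified by their ancestry: \<open>[]\<close> is the first individual and \<open>c # u\<close> is the
  child that \<open>u\<close> bears at the jump of its birth process from \<open>c\<close> to \<open>c + 1\<close>.  Individual \<open>u\<close>
  carries the birth process with holding times \<open>E u 0, E u 1, \<dots>\<close>.
\<close>

locale birth_clocks = prob_space M
  for M :: "'a measure" and lam :: "nat \<Rightarrow> real" and E :: "nat list \<Rightarrow> nat \<Rightarrow> 'a \<Rightarrow> real" +
  assumes lam_pos: "\<And>k. 0 < lam k"
    and clocks_exponential: "\<And>u k. distributed M lborel (E u k) (exponential_density (lam k))"
    and clocks_indep: "indep_vars (\<lambda>_. borel) (\<lambda>(u, k). E u k) (UNIV :: (nat list \<times> nat) set)"

text \<open>The definitions that follow are pathwise; \<open>e u k\<close> is a realisation of \<open>E u k\<close>.\<close>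

fun birth_time :: "(nat list \<Rightarrow> nat \<Rightarrow> real) \<Rightarrow> nat list \<Rightarrow> real" where
  "birth_time e [] = 0"
| "birth_time e (c # u) = birth_time e u + (\<Sum>i\<le>c. e u i)"

text \<open>
  The earliest born individual outside \<open>A\<close>.  Ties, which have probability zero, are broken by a
  fixed enumeration of all ancestries, so that the choice is measurable in \<open>e\<close>.
\<close>

definition next_born :: "(nat list \<Rightarrow> nat \<Rightarrow> real) \<Rightarrow> nat list set \<Rightarrow> nat list" where
  "next_born e A = from_nat (LEAST i. is_arg_min (birth_time e) (\<lambda>u. u \<notin> A) (from_nat i))"

primrec first_born :: "(nat list \<Rightarrow> nat \<Rightarrow> real) \<Rightarrow> nat \<Rightarrow> nat list set" where
  "first_born e 0 = {}"
| "first_born e (Suc x) = insert (next_born e (first_born e x)) (first_born e x)"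

text \<open>The individual with label \<open>x \<ge> 1\<close> in the order of birth, and its birth time.\<close>

definition individual :: "(nat list \<Rightarrow> nat \<Rightarrow> real) \<Rightarrow> nat \<Rightarrow> nat list" where
  "individual e x = next_born e (first_born e (x - 1))"

definition tau :: "(nat list \<Rightarrow> nat \<Rightarrow> real) \<Rightarrow> nat \<Rightarrow> real" where
  "tau e x = birth_time e (individual e x)"

definition is_parent :: "(nat list \<Rightarrow> nat \<Rightarrow> real) \<Rightarrow> nat \<Rightarrow> nat \<Rightarrow> bool" where
  "is_parent e y x \<longleftrightarrow> (\<exists>c. individual e x = c # individual e y)"

text \<open>The label \<open>(n, j)\<close> of the \<open>j\<close>-th individual of vertex \<open>n \<ge> 1\<close>; \<open>(n, 0) = (n - 1, m)\<close>.\<close>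

definition idx :: "nat \<Rightarrow> nat \<Rightarrow> nat \<Rightarrow> nat" where
  "idx m n j = m * (n - 1) + j"

definition edge_event :: "nat \<Rightarrow> (nat list \<Rightarrow> nat \<Rightarrow> real) \<Rightarrow> nat \<Rightarrow> nat \<Rightarrow> nat \<Rightarrow> bool" where
  "edge_event m e n j i \<longleftrightarrow> (\<exists>l\<in>{1..m}. is_parent e (idx m i l) (idx m n j))"

text \<open>
  A directed multigraph on positive integers: its vertex set and, for each ordered pair
  \<open>(x, y)\<close>, the number of edges from \<open>x\<close> to \<open>y\<close>.
\<close>

record multigraph =
  vertices :: "nat set"
  edge_count :: "nat \<Rightarrow> nat \<Rightarrow> nat"

definition CBP :: "nat \<Rightarrow> (nat list \<Rightarrow> nat \<Rightarrow> real) \<Rightarrow> real \<Rightarrow> multigraph" where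
  "CBP m e t =
     \<lparr> vertices = {n. 1 \<le> n \<and> tau e (idx m n 1) \<le> t},
       edge_count = (\<lambda>x y. if 1 \<le> x \<and> 1 \<le> y
          then card {j \<in> {1..m}. tau e (idx m x j) \<le> t \<and> edge_event m e x j y} else 0) \<rparr>"

definition in_degree :: "nat \<Rightarrow> (nat list \<Rightarrow> nat \<Rightarrow> real) \<Rightarrow> nat \<Rightarrow> real \<Rightarrow> nat" where
  "in_degree m e n t =
     (\<Sum>j=1..m. birth_process (e (individual e (idx m n j))) (t - tau e (idx m n j)))"

definition num_vertices :: "nat \<Rightarrow> (nat list \<Rightarrow> nat \<Rightarrow> real) \<Rightarrow> real \<Rightarrow> nat" where
  "num_vertices m e t = card (vertices (CBP m e t))"

definition num_vertices_deg :: "nat \<Rightarrow> (nat list \<Rightarrow> nat \<Rightarrow> real) \<Rightarrow> nat \<Rightarrow> real \<Rightarrow> nat" where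
  "num_vertices_deg m e k t = card {n \<in> vertices (CBP m e t). in_degree m e n t = k}"

definition degree_fraction :: "nat \<Rightarrow> (nat list \<Rightarrow> nat \<Rightarrow> real) \<Rightarrow> nat \<Rightarrow> real \<Rightarrow> real" where
  "degree_fraction m e k t = real (num_vertices_deg m e k t) / real (num_vertices m e t)"

text \<open>
  The product sigma-algebra on multigraphs, generated by the presence of each vertex and the
  multiplicity of each edge, and the sigma-algebra that a random multigraph generates.
\<close>

definition multigraph_algebra :: "multigraph measure" where
  "multigraph_algebra = sigma UNIV
     ((\<Union>n. {{G. n \<in> vertices G}}) \<union> (\<Union>x y k. {{G. edge_count G x y = k}}))"

definition generated_by :: "'a measure \<Rightarrow> ('a \<Rightarrow> multigraph) \<Rightarrow> 'a measure" where
  "generated_by M G = vimage_algebra (space M) G multigraph_algebra"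

definition tendsto_in_prob ::
    "'a measure \<Rightarrow> ('i \<Rightarrow> 'a \<Rightarrow> real) \<Rightarrow> real \<Rightarrow> 'i filter \<Rightarrow> bool" where
  "tendsto_in_prob M X c F \<longleftrightarrow>
     (\<forall>\<epsilon>>0. ((\<lambda>i. measure M {w \<in> space M. \<epsilon> < \<bar>X i w - c\<bar>}) \<longlongrightarrow> 0) F)"

end

theory Submission
  imports Defs "HOL-Library.Discrete_Functions"
begin


text \<open>
  While \<open>n + 1\<close> individuals are alive, \<open>n + 1\<close> exponential clocks of rate 1 are running, one for the
  next child of each of them.  By memorylessness the clock that rings first is uniformly
  distributed, and the residual clocks together with those of the new individual are again
  independent standard exponentials.  So the parents of the successive individuals are independent
  and uniform, which gives the transition probabilities.  The sum of the sizes of all vertices of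
  degree \<open>k\<close> then satisfies a linear stochastic recursion; comparing it with the fixed point
  \<open>p k = m (p (k - 1) - p k) + [k = 0]\<close> shows, by induction on \<open>k\<close>, that its mean square deviation
  from \<open>n p k\<close> is \<open>O(n)\<close>.  Borel--Cantelli along squares and interpolation give almost sure
  convergence, which transfers to continuous time because birth times increase to infinity.
\<close>

section \<open>Histories\<close>

text \<open>Everything probabilistic is reduced to counting. Almost surely a realisation follows
  exactly one history of each length, and all \<open>n!\<close> histories of length \<open>n\<close>
  are equally likely, so the probability of an event about the genealogy of the first
  \<open>n + 1\<close> individuals is a number of histories divided by \<open>n!\<close>, and the
  mean square estimates are inequalities between finite sums. The graph at a birth is a function of
  the history, so its sigma-algebra is coarser than that of the history; as the next parent is
  independent of the whole history, the conditional probability is a constant, the proportion of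
  individuals in the target vertex.

  The obstacle in the recursion is the youngest vertex, which may be incomplete: the ideal increment
  assumes full vertices. The error is affordable because the mean degree of that vertex is
  \<open>O(1/n)\<close>.

  Convergence in probability along the births would not directly settle continuous time, since the
  number of births before \<open>t\<close> depends on the same path. Almost sure convergence
  controls all late indices at once.\<close>

text \<open>
  A history lists the parents of all individuals but the first, the latest one in front.  In
  histories individuals and vertices are numbered from 0, so that individual \<open>x\<close> belongs to vertex
  \<open>x div m\<close>; \<open>people q ! x\<close> is its ancestry.
\<close>

primrec histories :: "nat \<Rightarrow> nat list set" where
  "histories 0 = {[]}"
| "histories (Suc n) = (\<lambda>(y, q). y # q) ` ({..n} \<times> histories n)"

primrec people :: "nat list \<Rightarrow> nat list list" where
  "people [] = [[]]"
| "people (y # q) = people q @ [count_list q y # people q ! y]"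

definition next_child :: "nat list \<Rightarrow> nat \<Rightarrow> nat list" where
  "next_child q y = count_list q y # people q ! y"

text \<open>Only the next unborn child of each living individual competes for the next birth. Strict
  inequalities leave out ties, so that a realisation follows at most one history of each
  length.\<close>

primrec follows :: "(nat list \<Rightarrow> nat \<Rightarrow> real) \<Rightarrow> nat list \<Rightarrow> bool" where
  "follows e [] \<longleftrightarrow> True"
| "follows e (y # q) \<longleftrightarrow> follows e q \<and>
     (\<forall>y'\<le>length q. y' \<noteq> y \<longrightarrow> birth_time e (next_child q y) < birth_time e (next_child q y'))"

lemma histories_SucE:
  assumes "q \<in> histories (Suc n)"
  obtains y q' where "q = y # q'" "y \<le> n" "q' \<in> histories n"
  using assms by auto

lemma finite_histories [simp]: "finite (histories n)"
  by (induction n) auto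

lemma histories_length: "q \<in> histories n \<Longrightarrow> length q = n"
  by (induction n arbitrary: q) auto

lemma histories_less: "q \<in> histories n \<Longrightarrow> p \<in> set q \<Longrightarrow> p < n"
  by (induction n arbitrary: q) (auto simp: less_Suc_eq)

lemma histories_count_eq_0: "q \<in> histories n \<Longrightarrow> n \<le> p \<Longrightarrow> count_list q p = 0"
  using histories_less[of q n p] by (auto simp: count_list_0_iff)

lemma sum_histories_Suc:
  "(\<Sum>q\<in>histories (Suc n). f q) = (\<Sum>q\<in>histories n. \<Sum>y\<le>n. f (y # q))"
proof -
  have "(\<Sum>q\<in>histories (Suc n). f q) = (\<Sum>x\<in>{..n} \<times> histories n. f ((\<lambda>(y, q). y # q) x))"
    unfolding histories.simps by (subst sum.reindex) (auto simp: inj_on_def)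
  also have "\<dots> = (\<Sum>y\<le>n. \<Sum>q\<in>histories n. f (y # q))"
    by (subst sum.cartesian_product) (auto simp: case_prod_unfold)
  finally show ?thesis by (subst sum.swap)
qed

lemma card_histories: "card (histories n) = fact n"
proof (induction n)
  case (Suc n)
  have "card (histories (Suc n)) = (\<Sum>q\<in>histories n. \<Sum>y\<le>n. 1)"
    unfolding card_eq_sum sum_histories_Suc ..
  then show ?case using Suc by simp
qed simp

lemma length_people [simp]: "length (people q) = Suc (length q)"
  by (induction q) auto

lemma people_Cons: "people (y # q) = people q @ [next_child q y]"
  by (simp add: next_child_def)

lemma nth_people_Cons:
  "people (y # q) ! x = (if x \<le> length q then people q ! x
     else [next_child q y] ! (x - Suc (length q)))"
  by (simp add: next_child_def nth_append less_Suc_eq_le)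

declare people.simps(2) [simp del]

lemma people_invariants:
  assumes "q \<in> histories n"
  shows distinct_people: "distinct (people q)"
    and root_in_people: "[] \<in> set (people q)"
    and child_in_people_iff:
      "\<And>y c. y \<le> n \<Longrightarrow> c # people q ! y \<in> set (people q) \<longleftrightarrow> c < count_list q y"
proof -
  \<comment> \<open>Closure under parents, the third conjunct, carries the induction: it shows that
    the newcomer, being absent so far, has no child in the list either.\<close>
  have "distinct (people q) \<and> [] \<in> set (people q) \<and>
     (\<forall>c u. c # u \<in> set (people q) \<longrightarrow> u \<in> set (people q)) \<and>
     (\<forall>y\<le>n. \<forall>c. c # people q ! y \<in> set (people q) \<longleftrightarrow> c < count_list q y)"
    using assms
  proof (induction n arbitrary: q)
    case 0
    then show ?case by auto
  next
    case (Suc n)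
    then obtain y q' where q: "q = y # q'" "y \<le> n" "q' \<in> histories n"
      by (elim histories_SucE)
    note IH = Suc.IH[OF q(3)]
    have len: "length q' = n"
      using q(3) by (rule histories_length)
    let ?u = "people q' ! y"
    have u: "?u \<in> set (people q')"
      using q(2) len by simp
    have new: "next_child q' y \<notin> set (people q')"
      using IH q(2) by (auto simp: next_child_def)
    have inj: "people q' ! z = ?u \<longleftrightarrow> z = y" if "z \<le> n" for z
      using IH q(2) len that by (simp add: nth_eq_iff_index_eq)
    have "c # people q ! z \<in> set (people q) \<longleftrightarrow> c < count_list q z" if z: "z \<le> Suc n" for z c
    proof (cases "z = Suc n")
      case True
      have "count_list q' (Suc n) = 0"
        using q(3) by (rule histories_count_eq_0) simp
      moreover have "y \<noteq> Suc n" using q(2) by simp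
      moreover have "c # next_child q' y \<notin> set (people q')"
        using IH new by blast
      ultimately show ?thesis
        using True len by (simp add: q people_Cons nth_append next_child_def)
    next
      case False
      with z have z: "z \<le> n" by simp
      then have "people q ! z = people q' ! z"
        by (simp add: q nth_people_Cons len)
      moreover have "c # people q' ! z = next_child q' y \<longleftrightarrow> z = y \<and> c = count_list q' y"
        using inj[OF z] by (auto simp: next_child_def)
      ultimately show ?thesis
        using IH z by (auto simp: q people_Cons)
    qed
    then show ?case
      using IH new u by (auto simp: q people_Cons) (auto simp: next_child_def)
  qed
  then show "distinct (people q)" "[] \<in> set (people q)"
    "\<And>y c. y \<le> n \<Longrightarrow> c # people q ! y \<in> set (people q) \<longleftrightarrow> c < count_list q y"
    by blast+
qed

lemma nth_people_eq_iff:
  "q \<in> histories n \<Longrightarrow> x \<le> n \<Longrightarrow> y \<le> n \<Longrightarrow> people q ! x = people q ! y \<longleftrightarrow> x = y"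
  using distinct_people[of q n] histories_length[of q n]
  by (simp add: nth_eq_iff_index_eq)

lemma next_child_notin_people:
  "q \<in> histories n \<Longrightarrow> y \<le> n \<Longrightarrow> next_child q y \<notin> set (people q)"
  by (simp add: next_child_def child_in_people_iff)

lemma next_child_eq_iff:
  "q \<in> histories n \<Longrightarrow> x \<le> n \<Longrightarrow> y \<le> n \<Longrightarrow> next_child q x = next_child q y \<longleftrightarrow> x = y"
  by (auto simp: next_child_def nth_people_eq_iff)

text \<open>Histories grow at the front, so the parent of individual \<open>x \<ge> 1\<close> is
  found at position \<open>n - x\<close>.\<close>

lemma people_parent:
  assumes "q \<in> histories n" "1 \<le> x" "x \<le> n"
  shows "\<exists>c. people q ! x = c # people q ! (q ! (n - x))"
  using assms
proof (induction n arbitrary: q)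
  case (Suc n)
  then obtain y q' where q: "q = y # q'" "y \<le> n" "q' \<in> histories n"
    by (elim histories_SucE)
  have len: "length q' = n"
    using q(3) by (rule histories_length)
  show ?case
  proof (cases "x = Suc n")
    case True
    then show ?thesis using q len by (simp add: nth_people_Cons next_child_def)
  next
    case False
    with Suc.prems have x: "x \<le> n" by simp
    then have "q' ! (n - x) < n"
      using histories_less[OF q(3)] len Suc.prems by simp
    then show ?thesis
      using Suc.IH[OF q(3) Suc.prems(2) x] x q len by (simp add: nth_people_Cons Suc_diff_le)
  qed
qed simp

lemma people_child_iff:
  assumes "q \<in> histories n" "x \<le> n" "y \<le> n"
  shows "(\<exists>c. people q ! x = c # people q ! y) \<longleftrightarrow> 1 \<le> x \<and> q ! (n - x) = y"
proof -
  have 0: "people q ! 0 = []"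
    by (induction q) (auto simp: people_Cons nth_append)
  show ?thesis
  proof (cases "1 \<le> x")
    case True
    then have "q ! (n - x) < n"
      using histories_less[OF assms(1)] histories_length[OF assms(1)] assms by simp
    then show ?thesis
      using people_parent[OF assms(1) True assms(2)] nth_people_eq_iff[OF assms(1), of _ y] assms True
      by (metis less_imp_le list.inject)
  next
    case False
    then have "x = 0" by simp
    then show ?thesis using 0 by simp
  qed
qed

section \<open>Births in continuous time\<close>

text \<open>Along the ancestry of an unborn individual, the topmost unborn member is a next child or
  a later sibling of one, and descendants are born later still. So the minimum over infinitely many
  unborn individuals is attained among \<open>n + 1\<close> candidates, whether or not the process
  explodes.\<close>

lemma closest_unborn:
  assumes q: "q \<in> histories n" and pos: "\<And>u k. 0 < e u k" and v: "v \<notin> set (people q)"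
  shows "\<exists>y\<le>n. v = next_child q y \<or> birth_time e (next_child q y) < birth_time e v"
  using v
proof (induction v)
  case Nil
  then show ?case using root_in_people[OF q] by simp
next
  case (Cons c u)
  show ?case
  proof (cases "u \<in> set (people q)")
    case True
    then obtain y where y: "y \<le> n" "u = people q ! y"
      using histories_length[OF q] by (auto simp: in_set_conv_nth less_Suc_eq_le)
    then have le: "count_list q y \<le> c"
      using Cons.prems child_in_people_iff[OF q y(1), of c] by simp
    have "(\<Sum>i\<le>count_list q y. e u i) < (\<Sum>i\<le>c. e u i)" if "count_list q y < c"
      using that pos by (intro sum_strict_mono2[where b = c]) (auto intro: less_imp_le)
    with le y show ?thesis
      by (intro exI[of _ y]) (auto simp: next_child_def order_less_le)
  next
    case False
    have "0 < (\<Sum>i\<le>c. e u i)"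
      using pos by (intro sum_pos) auto
    with Cons.IH[OF False] show ?thesis by (fastforce simp: next_child_def)
  qed
qed

text \<open>With a strict minimiser the tie-breaking enumeration is irrelevant: every index that
  qualifies decodes to it.\<close>

lemma next_born_eqI:
  assumes "v \<notin> A" and "\<And>u. u \<notin> A \<Longrightarrow> u \<noteq> v \<Longrightarrow> birth_time e v < birth_time e u"
  shows "next_born e A = v"
proof -
  have iff: "is_arg_min (birth_time e) (\<lambda>u. u \<notin> A) u \<longleftrightarrow> u = v" for u
    using assms unfolding is_arg_min_def by (metis order_less_asym)
  have "is_arg_min (birth_time e) (\<lambda>u. u \<notin> A) (from_nat (to_nat v))"
    by (simp add: iff)
  then have "is_arg_min (birth_time e) (\<lambda>u. u \<notin> A)
      (from_nat (LEAST i. is_arg_min (birth_time e) (\<lambda>u. u \<notin> A) (from_nat i)))"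
    by (rule LeastI)
  then show ?thesis
    unfolding next_born_def iff .
qed

lemma next_born_follows:
  assumes "q \<in> histories n" "\<And>u k. 0 < e u k" "follows e (y # q)" "y \<le> n"
  shows "next_born e (set (people q)) = next_child q y"
proof (rule next_born_eqI)
  show "next_child q y \<notin> set (people q)"
    using assms by (simp add: next_child_notin_people)
  fix v assume v: "v \<notin> set (people q)" "v \<noteq> next_child q y"
  from closest_unborn[of q n e, OF assms(1,2) v(1)] obtain y'
    where y': "y' \<le> n" "v = next_child q y' \<or> birth_time e (next_child q y') < birth_time e v"
    by auto
  then show "birth_time e (next_child q y) < birth_time e v"
    using assms(3) v(2) histories_length[OF assms(1)]
    by (cases "y' = y") (auto intro: less_trans)
qed

lemma next_born_empty:
  assumes "\<And>u k. 0 < e u k"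
  shows "next_born e {} = []"
proof (rule next_born_eqI)
  fix u :: "nat list" assume "u \<noteq> []"
  then show "birth_time e [] < birth_time e u"
  proof (induction u)
    case (Cons c u)
    have "0 < (\<Sum>i\<le>c. e u i)"
      using assms by (intro sum_pos) auto
    with Cons.IH show ?case by (cases "u = []") auto
  qed simp
qed simp

lemma first_born_follows:
  assumes "\<And>u k. 0 < e u k" "q \<in> histories n" "follows e q"
  shows "first_born e (Suc n) = set (people q)"
  using assms(2,3)
proof (induction n arbitrary: q)
  case 0
  then show ?case by (simp add: next_born_empty assms(1))
next
  case (Suc n)
  then obtain y q' where q: "q = y # q'" "y \<le> n" "q' \<in> histories n"
    by (elim histories_SucE)
  have "first_born e (Suc n) = set (people q')"
    using Suc.IH[OF q(3)] Suc.prems(2) q(1) by simp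
  moreover have "next_born e (set (people q')) = next_child q' y"
    using next_born_follows[of q' n e y] assms(1) Suc.prems(2) q by blast
  ultimately show ?case
    by (simp only: first_born.simps(2)[of e "Suc n"] q(1) people_Cons) simp
qed

lemma individual_follows:
  assumes "\<And>u k. 0 < e u k" "q \<in> histories n" "follows e q" "x \<le> n"
  shows "individual e (Suc x) = people q ! x"
  using assms(2-4)
proof (induction n arbitrary: q)
  case 0
  then show ?case by (simp add: individual_def next_born_empty assms(1))
next
  case (Suc n)
  then obtain y q' where q: "q = y # q'" "y \<le> n" "q' \<in> histories n"
    by (elim histories_SucE)
  have len: "length q' = n" using q(3) by (rule histories_length)
  have f: "follows e q'" using Suc.prems(2) q(1) by simp
  show ?case
  proof (cases "x = Suc n")
    case True
    have "next_born e (set (people q')) = next_child q' y"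
      using next_born_follows[of q' n e y] assms(1) Suc.prems(2) q by blast
    then show ?thesis
      using first_born_follows[of e q' n] assms(1) f q True len
      by (simp add: individual_def nth_people_Cons del: first_born.simps)
  next
    case False
    then show ?thesis
      using Suc.IH[OF q(3) f] Suc.prems(3) q len by (simp add: nth_people_Cons)
  qed
qed

text \<open>The candidates after a birth are the first child of the newcomer, the next sibling of
  the newcomer, and the losers of the last race.\<close>

lemma next_child_later:
  assumes pos: "\<And>u k. 0 < e u k" and "q \<in> histories n" "follows e q" "y \<le> n"
  shows "birth_time e (people q ! n) < birth_time e (next_child q y)"
  using assms(2-4)
proof (induction n arbitrary: q y)
  case 0
  then show ?case by (simp add: next_child_def pos)
next
  case (Suc n)
  then obtain z q' where q: "q = z # q'" "z \<le> n" "q' \<in> histories n"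
    by (elim histories_SucE)
  have len: "length q' = n" using q(3) by (rule histories_length)
  have last: "people q ! Suc n = next_child q' z"
    using q len by (simp add: nth_people_Cons)
  consider "y = Suc n" | "y = z" | "y \<le> n" "y \<noteq> z"
    using Suc.prems(3) by linarith
  then show ?case
  proof cases
    case 1
    have "next_child q y = 0 # next_child q' z"
      using histories_count_eq_0[OF q(3), of "Suc n"] 1 last q(1,2) by (simp add: next_child_def)
    then show ?thesis unfolding last by (simp add: pos)
  next
    case 2
    have "next_child q y = Suc (count_list q' z) # people q' ! z"
      using 2 q len by (simp add: next_child_def nth_people_Cons)
    then show ?thesis unfolding last by (simp add: next_child_def pos)
  next
    case 3
    have "next_child q y = next_child q' y"
      using 3 q len by (simp add: next_child_def nth_people_Cons)
    then show ?thesis unfolding last using Suc.prems(2) 3 q len by simp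
  qed
qed

lemma follows_unique:
  assumes "q \<in> histories n" "q' \<in> histories n" "follows e q" "follows e q'"
  shows "q = q'"
  using assms
proof (induction n arbitrary: q q')
  case (Suc n)
  then obtain y r y' r' where q: "q = y # r" "y \<le> n" "r \<in> histories n"
    and q': "q' = y' # r'" "y' \<le> n" "r' \<in> histories n"
    by (metis histories_SucE)
  then have "r = r'" using Suc by auto
  moreover have "y = y'"
    using Suc.prems(3,4) q q' histories_length[OF q(3)] \<open>r = r'\<close>
    by (metis follows.simps(2) order_less_asym)
  ultimately show ?case by (simp add: q q')
qed auto


section \<open>Independent exponential clocks\<close>

definition std_exp :: "real measure" where
  "std_exp = density lborel (exponential_density 1)"

abbreviation exp_product :: "'i set \<Rightarrow> ('i \<Rightarrow> real) measure" where
  "exp_product J \<equiv> PiM J (\<lambda>_. std_exp)"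

lemma sets_std_exp [simp, measurable_cong]: "sets std_exp = sets borel"
  by (simp add: std_exp_def)

lemma space_std_exp [simp]: "space std_exp = UNIV"
  by (simp add: std_exp_def)

lemma prob_space_std_exp: "prob_space std_exp"
  unfolding std_exp_def by (rule prob_space_exponential_density) simp

lemma prob_space_exp_product: "prob_space (exp_product J)"
  by (intro prob_space_PiM prob_space_std_exp)

lemma AE_std_exp_nonneg: "AE x in std_exp. 0 \<le> x"
  unfolding std_exp_def by (subst AE_density) (auto simp: exponential_density_def)

lemma nn_integral_std_exp_exp:
  assumes "0 \<le> a"
  shows "(\<integral>\<^sup>+x. ennreal (exp (- (a * x))) \<partial>std_exp) = ennreal (1 / (1 + a))"
proof -
  have "(\<integral>\<^sup>+x. ennreal (exp (- (a * x))) \<partial>std_exp) =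
      (\<integral>\<^sup>+x. ennreal (1 / (1 + a)) * ennreal (exponential_density (1 + a) x) \<partial>lborel)"
    unfolding std_exp_def using assms
    by (subst nn_integral_density)
       (auto intro!: nn_integral_cong simp: exponential_density_def exponential_density_nonneg
          ennreal_mult'[symmetric] exp_add[symmetric] field_simps)
  also have "\<dots> = ennreal (1 / (1 + a)) * (\<integral>\<^sup>+x. ennreal (exponential_density (1 + a) x) \<partial>lborel)"
    by (rule nn_integral_cmult) simp
  also have "(\<integral>\<^sup>+x. ennreal (exponential_density (1 + a) x) \<partial>lborel) = 1"
    using prob_space.emeasure_space_1[OF prob_space_exponential_density, of "1 + a"] assms
    by (simp add: emeasure_density)
  finally show ?thesis by simp
qed

lemma std_exp_memoryless:
  assumes "0 \<le> x" and [measurable]: "g \<in> borel_measurable borel"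
  shows "(\<integral>\<^sup>+t. (if x < t then g (t - x) else 0) \<partial>std_exp)
    = ennreal (exp (- x)) * (\<integral>\<^sup>+t. g t \<partial>std_exp)"
proof -
  have "(\<integral>\<^sup>+t. (if x < t then g (t - x) else 0) \<partial>std_exp)
      = (\<integral>\<^sup>+t. ennreal (exponential_density 1 t) * (if x < t then g (t - x) else 0) \<partial>lborel)"
    unfolding std_exp_def by (subst nn_integral_density) auto
  also have "\<dots> = (\<integral>\<^sup>+t. ennreal (exponential_density 1 (x + t)) * (if 0 < t then g t else 0) \<partial>lborel)"
    by (subst nn_integral_real_affine[where c = 1 and t = x]) (auto intro!: nn_integral_cong)
  \<comment> \<open>The integrands can differ only at \<open>t = 0\<close>, where the left one
    vanishes while the density does not.\<close>
  also have "\<dots> = (\<integral>\<^sup>+t. ennreal (exp (- x)) * (ennreal (exponential_density 1 t) * g t) \<partial>lborel)"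
    using AE_lborel_singleton[of 0] assms(1)
    by (intro nn_integral_cong_AE)
       (auto simp: exponential_density_def mult.assoc[symmetric] ennreal_mult'[symmetric]
          exp_add[symmetric])
  also have "\<dots> = ennreal (exp (- x)) * (\<integral>\<^sup>+t. ennreal (exponential_density 1 t) * g t \<partial>lborel)"
    by (rule nn_integral_cmult) simp
  also have "(\<integral>\<^sup>+t. ennreal (exponential_density 1 t) * g t \<partial>lborel) = (\<integral>\<^sup>+t. g t \<partial>std_exp)"
    unfolding std_exp_def by (subst nn_integral_density) auto
  finally show ?thesis .
qed

lemma measurable_fun_upd_exp_product [measurable]:
  "(\<lambda>(t, z). z(v := t)) \<in> std_exp \<Otimes>\<^sub>M exp_product J \<rightarrow>\<^sub>M exp_product (insert v J)"
  unfolding case_prod_unfold by (rule measurable_fun_upd[where J = J]) auto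

text \<open>Both orders of integration are used: a race fixes the winning clock first, whereas
  memorylessness is applied to one clock with all others held fixed.\<close>

lemma nn_integral_exp_product_insert:
  assumes "G \<in> borel_measurable (exp_product (insert v J))"
  shows "(\<integral>\<^sup>+z. G z \<partial>exp_product (insert v J)) = (\<integral>\<^sup>+t. \<integral>\<^sup>+z. G (z(v := t)) \<partial>exp_product J \<partial>std_exp)"
    and "(\<integral>\<^sup>+z. G z \<partial>exp_product (insert v J)) = (\<integral>\<^sup>+z. \<integral>\<^sup>+t. G (z(v := t)) \<partial>std_exp \<partial>exp_product J)"
proof -
  interpret e: prob_space std_exp by (rule prob_space_std_exp)
  interpret p: prob_space "exp_product J" by (rule prob_space_exp_product)
  interpret pair_sigma_finite std_exp "exp_product J" ..
  define H where "H = (\<lambda>x. G ((snd x)(v := fst x)))"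
  have H: "H \<in> borel_measurable (std_exp \<Otimes>\<^sub>M exp_product J)"
    using measurable_compose[OF measurable_fun_upd_exp_product assms]
    by (simp add: H_def case_prod_unfold)
  have "(\<integral>\<^sup>+z. G z \<partial>exp_product (insert v J)) = (\<integral>\<^sup>+x. H x \<partial>(std_exp \<Otimes>\<^sub>M exp_product J))"
    using assms
    by (subst distr_pair_PiM_eq_PiM[symmetric])
       (auto simp: prob_space_std_exp nn_integral_distr H_def case_prod_unfold)
  then show "(\<integral>\<^sup>+z. G z \<partial>exp_product (insert v J)) = (\<integral>\<^sup>+t. \<integral>\<^sup>+z. G (z(v := t)) \<partial>exp_product J \<partial>std_exp)"
    and "(\<integral>\<^sup>+z. G z \<partial>exp_product (insert v J)) = (\<integral>\<^sup>+z. \<integral>\<^sup>+t. G (z(v := t)) \<partial>std_exp \<partial>exp_product J)"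
    using p.nn_integral_fst[OF H] nn_integral_snd[OF H] by (simp_all add: H_def)
qed

text \<open>The clocks of \<open>F\<close> are running and lose \<open>x\<close> units of time;
  those outside \<open>F\<close> have not started and keep their full value.\<close>

definition lower_on :: "'i set \<Rightarrow> real \<Rightarrow> ('i \<Rightarrow> real) \<Rightarrow> 'i \<Rightarrow> real" where
  "lower_on F x z = (\<lambda>v. if v \<in> F then z v - x else z v)"

lemma measurable_lower_on [measurable (raw)]:
  assumes "F \<subseteq> J" and [measurable]: "f \<in> borel_measurable N" "g \<in> N \<rightarrow>\<^sub>M exp_product J"
  shows "(\<lambda>w. lower_on F (f w) (g w)) \<in> N \<rightarrow>\<^sub>M exp_product J"
  unfolding lower_on_def
proof (rule measurable_PiM_single')
  fix v assume "v \<in> J"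
  then have "(\<lambda>w. g w v) \<in> N \<rightarrow>\<^sub>M std_exp"
    by (rule measurable_compose[OF assms(3) measurable_component_singleton])
  then have [measurable]: "(\<lambda>w. g w v) \<in> borel_measurable N"
    by (simp cong: measurable_cong_sets)
  have "(\<lambda>w. g w v - f w) \<in> borel_measurable N"
    by measurable
  with \<open>(\<lambda>w. g w v) \<in> N \<rightarrow>\<^sub>M std_exp\<close> show "(\<lambda>w. if v \<in> F then g w v - f w else g w v) \<in> N \<rightarrow>\<^sub>M std_exp"
    by (cases "v \<in> F") (simp_all cong: measurable_cong_sets)
next
  have "g w \<in> extensional J" if "w \<in> space N" for w
    using measurable_space[OF assms(3) that] by (auto simp: space_PiM PiE_def)
  then show "(\<lambda>w v. if v \<in> F then g w v - f w else g w v) \<in> space N \<rightarrow> (\<Pi>\<^sub>E i\<in>J. space std_exp)"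
    using assms(1) by (auto simp: PiE_def extensional_def)
qed

text \<open>One clock of \<open>F\<close> at a time is integrated innermost, where the
  one-dimensional law applies, and is then put back into the product. The set \<open>J\<close> may
  be infinite, as only the finitely many coordinates in \<open>F\<close> are touched.\<close>

lemma exp_product_memoryless:
  assumes "finite F" "F \<subseteq> J" "0 \<le> x" "G \<in> borel_measurable (exp_product J)"
  shows "(\<integral>\<^sup>+z. (if \<forall>v\<in>F. x < z v then G (lower_on F x z) else 0) \<partial>exp_product J)
    = ennreal (exp (- (real (card F) * x))) * (\<integral>\<^sup>+z. G z \<partial>exp_product J)"
  using assms(1,2,4)
proof (induction F arbitrary: G)
  case empty
  then show ?case by (simp add: lower_on_def)
next
  case (insert v F)
  define K where "K = J - {v}"
  have J: "J = insert v K" "v \<notin> K" and F: "F \<subseteq> K" "finite F"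
    using insert.prems insert.hyps by (auto simp: K_def)
  note G [measurable] = insert.prems(2)[unfolded J(1)]
  have [measurable]: "i \<in> insert v F \<Longrightarrow> i \<in> insert v K" "i \<in> F \<Longrightarrow> i \<in> insert v K" for i
    using F by auto
  have sub: "insert v F \<subseteq> insert v K" "F \<subseteq> insert v K" using F by auto
  have [measurable]: "Measurable.pred (exp_product (insert v K)) (\<lambda>z. \<forall>v\<in>insert v F. x < z v)"
     "Measurable.pred (exp_product (insert v K)) (\<lambda>z. \<forall>v\<in>F. x < z v)"
    using F(2) by (intro pred_intros_finite; measurable)+
  have [measurable]: "lower_on (insert v F) x \<in> exp_product (insert v K) \<rightarrow>\<^sub>M exp_product (insert v K)"
     "lower_on F x \<in> exp_product (insert v K) \<rightarrow>\<^sub>M exp_product (insert v K)"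
    using measurable_lower_on[OF sub(1), of "\<lambda>_. x" "exp_product (insert v K)" "\<lambda>z. z"]
      measurable_lower_on[OF sub(2), of "\<lambda>_. x" "exp_product (insert v K)" "\<lambda>z. z"] by simp_all
  have "(\<integral>\<^sup>+z. (if \<forall>v\<in>insert v F. x < z v then G (lower_on (insert v F) x z) else 0) \<partial>exp_product J)
      = (\<integral>\<^sup>+z. \<integral>\<^sup>+t. (if \<forall>i\<in>insert v F. x < (z(v := t)) i
            then G (lower_on (insert v F) x (z(v := t))) else 0) \<partial>std_exp \<partial>exp_product K)"
    unfolding J(1) by (rule nn_integral_exp_product_insert(2)) measurable
  also have "\<dots> = (\<integral>\<^sup>+z. ennreal (exp (- x)) * (\<integral>\<^sup>+t. (if \<forall>i\<in>F. x < z i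
            then G ((lower_on F x z)(v := t)) else 0) \<partial>std_exp) \<partial>exp_product K)"
  proof (rule nn_integral_cong)
    fix z assume z: "z \<in> space (exp_product K)"
    define g where "g t = (if \<forall>i\<in>F. x < z i then G ((lower_on F x z)(v := t)) else 0)" for t
    have l: "lower_on F x z \<in> space (exp_product K)"
      using measurable_space[OF measurable_lower_on[OF F(1), of "\<lambda>_. x" "exp_product K" "\<lambda>z. z"] z] by simp
    have "(\<lambda>t. (lower_on F x z)(v := t)) \<in> std_exp \<rightarrow>\<^sub>M exp_product (insert v K)"
      using measurable_compose[OF _ measurable_fun_upd_exp_product, of "\<lambda>t. (t, lower_on F x z)" std_exp K v] l
      by simp
    then have "(\<lambda>t. G ((lower_on F x z)(v := t))) \<in> borel_measurable std_exp"
      by measurable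
    then have [measurable]: "g \<in> borel_measurable borel"
      unfolding g_def by (simp cong: measurable_cong_sets)
    have "(if \<forall>i\<in>insert v F. x < (z(v := t)) i then G (lower_on (insert v F) x (z(v := t))) else 0)
        = (if x < t then g (t - x) else 0)" for t
    proof -
      have "lower_on (insert v F) x (z(v := t)) = (lower_on F x z)(v := t - x)"
        by (auto simp: lower_on_def)
      moreover have "(\<forall>i\<in>insert v F. x < (z(v := t)) i) \<longleftrightarrow> x < t \<and> (\<forall>i\<in>F. x < z i)"
        using insert.hyps(2) by auto
      ultimately show ?thesis by (simp add: g_def)
    qed
    then show "(\<integral>\<^sup>+t. (if \<forall>i\<in>insert v F. x < (z(v := t)) i
            then G (lower_on (insert v F) x (z(v := t))) else 0) \<partial>std_exp)
        = ennreal (exp (- x)) * (\<integral>\<^sup>+t. (if \<forall>i\<in>F. x < z i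
            then G ((lower_on F x z)(v := t)) else 0) \<partial>std_exp)"
      using std_exp_memoryless[OF assms(3), of g] by (simp add: g_def)
  qed
  \<comment> \<open>The coordinate \<open>v\<close> is free again and lies outside \<open>F\<close>,
    so the double integral folds back into the product over \<open>J\<close>.\<close>
  also have "\<dots> = (\<integral>\<^sup>+z. \<integral>\<^sup>+t. ennreal (exp (- x)) * (if \<forall>i\<in>F. x < (z(v := t)) i
            then G (lower_on F x (z(v := t))) else 0) \<partial>std_exp \<partial>exp_product K)"
  proof (rule nn_integral_cong)
    fix z assume z: "z \<in> space (exp_product K)"
    have "(\<lambda>t. z(v := t)) \<in> std_exp \<rightarrow>\<^sub>M exp_product (insert v K)"
      using measurable_compose[OF _ measurable_fun_upd_exp_product, of "\<lambda>t. (t, z)" std_exp K v] z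
      by simp
    then have "(\<lambda>t. if \<forall>i\<in>F. x < (z(v := t)) i then G (lower_on F x (z(v := t))) else 0)
        \<in> borel_measurable std_exp"
      by measurable
    then have "(\<integral>\<^sup>+t. ennreal (exp (- x)) * (if \<forall>i\<in>F. x < (z(v := t)) i
            then G (lower_on F x (z(v := t))) else 0) \<partial>std_exp)
       = ennreal (exp (- x)) * (\<integral>\<^sup>+t. (if \<forall>i\<in>F. x < (z(v := t)) i
            then G (lower_on F x (z(v := t))) else 0) \<partial>std_exp)"
      by (rule nn_integral_cmult)
    moreover have "(if \<forall>i\<in>F. x < (z(v := t)) i then G (lower_on F x (z(v := t))) else 0)
        = (if \<forall>i\<in>F. x < z i then G ((lower_on F x z)(v := t)) else 0)" for t
    proof -
      have "lower_on F x (z(v := t)) = (lower_on F x z)(v := t)"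
        using insert.hyps(2) by (auto simp: lower_on_def)
      moreover have "(\<forall>i\<in>F. x < (z(v := t)) i) \<longleftrightarrow> (\<forall>i\<in>F. x < z i)"
        using insert.hyps(2) by auto
      ultimately show ?thesis by simp
    qed
    ultimately show "ennreal (exp (- x)) * (\<integral>\<^sup>+t. (if \<forall>i\<in>F. x < z i
            then G ((lower_on F x z)(v := t)) else 0) \<partial>std_exp) =
        (\<integral>\<^sup>+t. ennreal (exp (- x)) * (if \<forall>i\<in>F. x < (z(v := t)) i
            then G (lower_on F x (z(v := t))) else 0) \<partial>std_exp)"
      by simp
  qed
  also have "\<dots> = (\<integral>\<^sup>+z. ennreal (exp (- x)) * (if \<forall>i\<in>F. x < z i
            then G (lower_on F x z) else 0) \<partial>exp_product J)"
    unfolding J(1) by (rule nn_integral_exp_product_insert(2)[symmetric]) measurable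
  also have "\<dots> = ennreal (exp (- x)) * (\<integral>\<^sup>+z. (if \<forall>i\<in>F. x < z i
            then G (lower_on F x z) else 0) \<partial>exp_product J)"
    unfolding J(1) by (rule nn_integral_cmult) measurable
  also have "\<dots> = ennreal (exp (- x)) * (ennreal (exp (- (real (card F) * x))) * (\<integral>\<^sup>+z. G z \<partial>exp_product J))"
    using insert.prems by (subst insert.IH) auto
  also have "\<dots> = ennreal (exp (- (real (card (insert v F)) * x))) * (\<integral>\<^sup>+z. G z \<partial>exp_product J)"
    using insert.hyps
    by (simp add: mult.assoc[symmetric] ennreal_mult'[symmetric] exp_add[symmetric] distrib_right)
  finally show ?case .
qed

text \<open>The clock \<open>f\<close> wins a race against \<open>F\<close>.  Its duration is exponential of rate \<open>card F + 1\<close> and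
  independent of the residual times of the other clocks.\<close>

lemma exp_product_race:
  assumes "finite F" "F \<subseteq> J" "f \<notin> J" "0 \<le> s" and G [measurable]: "G \<in> borel_measurable (exp_product J)"
  shows "(\<integral>\<^sup>+z. (if \<forall>v\<in>F. z f < z v
        then ennreal (exp (- (s * z f))) * G (restrict (lower_on F (z f) z) J) else 0)
      \<partial>exp_product (insert f J))
    = ennreal (1 / (1 + real (card F) + s)) * (\<integral>\<^sup>+z. G z \<partial>exp_product J)"
proof -
  have F [measurable]: "i \<in> F \<Longrightarrow> i \<in> insert f J" for i using assms(2) by auto
  have [measurable]: "Measurable.pred (exp_product (insert f J)) (\<lambda>z. \<forall>v\<in>F. z f < z v)"
    using assms(1) by (intro pred_intros_finite; measurable)
  have [measurable]: "(\<lambda>z. lower_on F (z f) z) \<in> exp_product (insert f J) \<rightarrow>\<^sub>M exp_product (insert f J)"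
    by (rule measurable_lower_on) (use assms(2) in auto)
  have [measurable]: "(\<lambda>z. restrict z J) \<in> exp_product (insert f J) \<rightarrow>\<^sub>M exp_product J"
    by (rule measurable_restrict_subset) auto
  have "(\<integral>\<^sup>+z. (if \<forall>v\<in>F. z f < z v
        then ennreal (exp (- (s * z f))) * G (restrict (lower_on F (z f) z) J) else 0)
      \<partial>exp_product (insert f J)) =
     (\<integral>\<^sup>+x. \<integral>\<^sup>+z. (if \<forall>v\<in>F. (z(f := x)) f < (z(f := x)) v
        then ennreal (exp (- (s * (z(f := x)) f))) *
          G (restrict (lower_on F ((z(f := x)) f) (z(f := x))) J) else 0)
      \<partial>exp_product J \<partial>std_exp)"
    by (rule nn_integral_exp_product_insert(1)) measurable
  \<comment> \<open>For a winning time \<open>x\<close>, all clocks of \<open>F\<close> exceed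
    \<open>x\<close> with weight \<open>exp (- (card F * x))\<close>, and given this their residuals
    have the original product law.\<close>
  also have "\<dots> = (\<integral>\<^sup>+x. ennreal (exp (- ((real (card F) + s) * x))) * (\<integral>\<^sup>+z. G z \<partial>exp_product J) \<partial>std_exp)"
    proof (rule nn_integral_cong_AE, use AE_std_exp_nonneg in eventually_elim)
    case (elim x)
    have [measurable]: "Measurable.pred (exp_product J) (\<lambda>z. \<forall>v\<in>F. x < z v)"
      using assms(1,2) by (intro pred_intros_finite measurable_compose[OF measurable_component_singleton]) auto
    have [measurable]: "lower_on F x \<in> exp_product J \<rightarrow>\<^sub>M exp_product J"
      using measurable_lower_on[OF assms(2), of "\<lambda>_. x" "exp_product J" "\<lambda>z. z"] by simp
    have "(\<integral>\<^sup>+z. (if \<forall>v\<in>F. (z(f := x)) f < (z(f := x)) v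
        then ennreal (exp (- (s * (z(f := x)) f))) *
          G (restrict (lower_on F ((z(f := x)) f) (z(f := x))) J) else 0) \<partial>exp_product J)
      = (\<integral>\<^sup>+z. ennreal (exp (- (s * x))) * (if \<forall>v\<in>F. x < z v then G (lower_on F x z) else 0) \<partial>exp_product J)"
    proof (rule nn_integral_cong)
      fix z assume "z \<in> space (exp_product J)"
      then have "restrict (lower_on F x (z(f := x))) J = lower_on F x z"
        using assms(2,3) by (auto simp: lower_on_def space_PiM PiE_def extensional_def fun_eq_iff)
      moreover have "(\<forall>v\<in>F. x < (z(f := x)) v) \<longleftrightarrow> (\<forall>v\<in>F. x < z v)"
        using assms(2,3) by auto
      ultimately show "(if \<forall>v\<in>F. (z(f := x)) f < (z(f := x)) v
        then ennreal (exp (- (s * (z(f := x)) f))) *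
          G (restrict (lower_on F ((z(f := x)) f) (z(f := x))) J) else 0)
       = ennreal (exp (- (s * x))) * (if \<forall>v\<in>F. x < z v then G (lower_on F x z) else 0)"
        by simp
    qed
    also have "\<dots> = ennreal (exp (- (s * x))) *
        (\<integral>\<^sup>+z. (if \<forall>v\<in>F. x < z v then G (lower_on F x z) else 0) \<partial>exp_product J)"
      by (rule nn_integral_cmult) measurable
    also have "\<dots> = ennreal (exp (- ((real (card F) + s) * x))) * (\<integral>\<^sup>+z. G z \<partial>exp_product J)"
      unfolding exp_product_memoryless[OF assms(1,2) elim G]
      by (simp add: mult.assoc[symmetric] ennreal_mult'[symmetric] exp_add[symmetric] algebra_simps)
    finally show ?case .
  qed
  \<comment> \<open>The density of the winning clock adds rate 1 to
    \<open>card F + s\<close>.\<close>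
  also have "\<dots> = ennreal (1 / (1 + real (card F) + s)) * (\<integral>\<^sup>+z. G z \<partial>exp_product J)"
    using nn_integral_std_exp_exp[of "real (card F) + s"] assms(4)
    by (subst nn_integral_multc) (auto simp: add.assoc)
  finally show ?thesis .
qed


section \<open>Residual clocks at the successive births\<close>

definition next_clock :: "nat list \<Rightarrow> nat \<Rightarrow> nat list \<times> nat" where
  "next_clock q y = (people q ! y, count_list q y)"

definition unused :: "nat list \<Rightarrow> (nat list \<times> nat) set" where
  "unused q = {(u, k). k # u \<notin> set (people q)}"

text \<open>
  The clock \<open>(u, k)\<close> measures the time between the births of the children \<open>k - 1\<close> and \<open>k\<close> of \<open>u\<close>;
  \<open>residual e q\<close> collects what is left of all clocks at the birth of the last individual of \<open>q\<close>.
\<close>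

primrec residual :: "(nat list \<Rightarrow> nat \<Rightarrow> real) \<Rightarrow> nat list \<Rightarrow> nat list \<times> nat \<Rightarrow> real" where
  "residual e [] = (\<lambda>(u, k). e u k)"
| "residual e (y # q) = restrict
     (lower_on (next_clock q ` ({..length q} - {y})) (residual e q (next_clock q y)) (residual e q))
     (unused (y # q))"

lemma next_child_eq_Cons: "next_child q y = snd (next_clock q y) # fst (next_clock q y)"
  by (simp add: next_child_def next_clock_def)

lemma next_clock_eq_iff:
  "q \<in> histories n \<Longrightarrow> x \<le> n \<Longrightarrow> y \<le> n \<Longrightarrow> next_clock q x = next_clock q y \<longleftrightarrow> x = y"
  using next_child_eq_iff[of q n x y] by (auto simp: next_child_eq_Cons)

lemma next_clock_unused:
  "q \<in> histories n \<Longrightarrow> y \<le> n \<Longrightarrow> next_clock q y \<in> unused q"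
  using next_child_notin_people[of q n y] by (simp add: unused_def next_child_def next_clock_def)

lemma unused_Nil: "unused [] = UNIV"
  by (auto simp: unused_def)

lemma unused_Cons: "unused (y # q) = unused q - {next_clock q y}"
  by (auto simp: unused_def people_Cons next_child_def next_clock_def)

lemma residual_next_clock:
  assumes "q \<in> histories n" "y \<le> n"
  shows "residual e q (next_clock q y) = birth_time e (next_child q y) - birth_time e (people q ! n)"
proof -
  \<comment> \<open>The second conjunct serves the two clocks that start at a birth, the first one
    of the newcomer and the next one of its parent: neither has ever been lowered.\<close>
  have "(\<forall>y\<le>n. residual e q (next_clock q y) =
          birth_time e (next_child q y) - birth_time e (people q ! n)) \<and>
        (\<forall>u k. (u, k) \<in> unused q \<longrightarrow> (u, k) \<notin> next_clock q ` {..n} \<longrightarrow> residual e q (u, k) = e u k)"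
    using assms(1)
  proof (induction n arbitrary: q)
    case 0
    then show ?case by (simp add: next_clock_def next_child_def)
  next
    case (Suc n)
    then obtain y r where q: "q = y # r" "y \<le> n" and r: "r \<in> histories n"
      by (elim histories_SucE)
    have len: "length r = n" using r by (rule histories_length)
    define f F where "f = next_clock r y" and "F = next_clock r ` ({..n} - {y})"
    have res: "residual e q v = (if v \<in> F then residual e r v - residual e r f else residual e r v)"
      if "v \<in> unused q" for v
      using that q len by (simp add: f_def F_def lower_on_def)
    have IH1: "residual e r (next_clock r z) = birth_time e (next_child r z) - birth_time e (people r ! n)"
      if "z \<le> n" for z using Suc.IH[OF r] that by blast
    have IH2: "residual e r (u, k) = e u k"
      if "(u, k) \<in> unused r" "(u, k) \<notin> next_clock r ` {..n}" for u k
      using Suc.IH[OF r] that by blast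
    have last: "people q ! Suc n = next_child r y"
      using q len by (simp add: nth_people_Cons)
    have split: "next_clock r ` {..n} = insert f F"
      using q(2) by (auto simp: f_def F_def)
    have old: "next_clock q z = next_clock r z" if "z \<le> n" "z \<noteq> y" for z
      using that len q by (simp add: next_clock_def nth_people_Cons)
    have "residual e q (next_clock q z) = birth_time e (next_child q z) - birth_time e (people q ! Suc n)"
      if z: "z \<le> Suc n" for z
    proof -
      have z_unused: "next_clock q z \<in> unused q"
        using Suc.prems z by (rule next_clock_unused)
      have zr: "next_clock q z \<in> unused r"
        using z_unused by (simp add: q unused_Cons)
      consider "z = Suc n" | "z = y" | "z \<le> n" "z \<noteq> y"
        using z by linarith
      then show ?thesis
      proof cases
        case 1
        have c: "next_clock q z = (next_child r y, 0)"
          using 1 histories_count_eq_0[OF r, of "Suc n"] last q(1,2) by (simp add: next_clock_def)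
        have "(next_child r y, 0) \<notin> next_clock r ` {..n}"
          using next_child_notin_people[OF r q(2)] len
          by (auto simp: next_clock_def)
        then have "residual e q (next_clock q z) = e (next_child r y) 0"
          using IH2[of "next_child r y" 0] zr res[OF z_unused] unfolding c split by auto
        moreover have "next_child q z = 0 # next_child r y"
          using c by (simp add: next_child_eq_Cons[of q])
        ultimately show ?thesis by (simp add: last)
      next
        case 2
        have c: "next_clock q z = (people r ! y, Suc (count_list r y))"
          using 2 q len by (simp add: next_clock_def nth_people_Cons)
        have "(people r ! y, Suc (count_list r y)) \<notin> next_clock r ` {..n}"
        proof
          assume "(people r ! y, Suc (count_list r y)) \<in> next_clock r ` {..n}"
          then obtain x where x: "x \<le> n" "people r ! y = people r ! x" "Suc (count_list r y) = count_list r x"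
            by (auto simp: next_clock_def)
          then have "y = x" using nth_people_eq_iff[OF r q(2) x(1)] by simp
          with x(3) show False by simp
        qed
        then have "residual e q (next_clock q z) = e (people r ! y) (Suc (count_list r y))"
          using IH2[of "people r ! y" "Suc (count_list r y)"] zr res[OF z_unused]
          unfolding c split by auto
        moreover have "next_child q z = Suc (count_list r y) # people r ! y"
          using c by (simp add: next_child_eq_Cons[of q])
        ultimately show ?thesis by (simp add: last next_child_def[of r])
      next
        case 3
        then have "next_clock r z \<in> F" by (auto simp: F_def)
        then have "residual e q (next_clock q z) = residual e r (next_clock r z) - residual e r f"
          using res[OF z_unused] old[OF 3] by simp
        moreover have "next_child q z = next_child r z"
          using old[OF 3] by (simp add: next_child_eq_Cons)
        ultimately show ?thesis
          using IH1[OF 3(1)] IH1[OF q(2)] by (simp add: f_def last)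
      qed
    qed
    moreover have "residual e q (u, k) = e u k"
      if "(u, k) \<in> unused q" "(u, k) \<notin> next_clock q ` {..Suc n}" for u k
    proof -
      have "(u, k) \<notin> F"
      proof
        assume "(u, k) \<in> F"
        then obtain x where "x \<le> n" "x \<noteq> y" "(u, k) = next_clock r x"
          by (auto simp: F_def)
        then have "(u, k) = next_clock q x" "x \<le> Suc n" using old by simp_all
        with that(2) show False by blast
      qed
      moreover have "(u, k) \<in> unused r" "(u, k) \<noteq> f"
        using that(1) by (auto simp: q unused_Cons f_def)
      ultimately show ?thesis
        using IH2[of u k] split res[OF that(1)] by simp
    qed
    ultimately show ?case by blast
  qed
  then show ?thesis using assms(2) by blast
qed

text \<open>All running clocks are measured from the birth of the last individual, so comparing
  candidates by birth time is comparing residuals.\<close>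

lemma follows_Cons_residual:
  assumes "q \<in> histories n" "y \<le> n"
  shows "follows e (y # q) \<longleftrightarrow> follows e q \<and>
    (\<forall>v\<in>next_clock q ` ({..n} - {y}). residual e q (next_clock q y) < residual e q v)"
proof -
  have "residual e q (next_clock q y) < residual e q (next_clock q y') \<longleftrightarrow>
      birth_time e (next_child q y) < birth_time e (next_child q y')" if "y' \<le> n" for y'
    using residual_next_clock[OF assms(1)] assms(2) that by simp
  then show ?thesis
    using histories_length[OF assms(1)] by auto
qed

section \<open>The law of the history and absence of explosion\<close>

locale unit_birth_clocks = birth_clocks M "\<lambda>_. 1" E for M :: "'a measure" and E
begin

abbreviation path :: "'a \<Rightarrow> nat list \<Rightarrow> nat \<Rightarrow> real" where
  "path w \<equiv> \<lambda>u k. E u k w"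

lemma measurable_clock [measurable]: "E u k \<in> borel_measurable M"
  using clocks_exponential[of u k] by (simp add: distributed_def cong: measurable_cong_sets)

lemma measurable_birth_time [measurable]: "(\<lambda>w. birth_time (path w) u) \<in> borel_measurable M"
  by (induction u) simp_all

lemma measurable_follows [measurable]: "Measurable.pred M (\<lambda>w. follows (path w) q)"
  by (induction q) simp_all

lemma clocks_law:
  "distr M (exp_product UNIV) (\<lambda>w (u, k). E u k w) = exp_product UNIV"
proof -
  let ?E = "\<lambda>(u, k). E u k"
  have E: "?E i \<in> borel_measurable M" for i by (cases i) simp
  have 1: "distr M borel (?E i) = std_exp" for i
  proof (cases i)
    case (Pair u k)
    have "distr M borel (E u k) = distr M lborel (E u k)"
      by (rule distr_cong) auto
    also have "\<dots> = std_exp"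
      using clocks_exponential[of u k] unfolding std_exp_def by (rule distributed_distr_eq_density)
    finally show ?thesis by (simp add: Pair)
  qed
  have "distr M (\<Pi>\<^sub>M i\<in>UNIV. borel) (\<lambda>x. \<lambda>i\<in>UNIV. ?E i x) = (\<Pi>\<^sub>M i\<in>UNIV. distr M borel (?E i))"
    using clocks_indep E by (subst indep_vars_iff_distr_eq_PiM'[symmetric]) auto
  also have "\<dots> = exp_product UNIV" by (simp add: 1)
  also have "distr M (\<Pi>\<^sub>M i\<in>UNIV. borel) (\<lambda>x. \<lambda>i\<in>UNIV. ?E i x) = distr M (exp_product UNIV) (\<lambda>w (u, k). E u k w)"
    by (rule distr_cong) (auto intro!: sets_PiM_cong simp: fun_eq_iff)
  finally show ?thesis .
qed

lemma measurable_residual [measurable]: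
  "q \<in> histories n \<Longrightarrow> (\<lambda>w. residual (path w) q) \<in> M \<rightarrow>\<^sub>M exp_product (unused q)"
proof (induction n arbitrary: q)
  case 0
  have "(\<lambda>w (u, k). E u k w) \<in> M \<rightarrow>\<^sub>M exp_product UNIV"
    by (rule measurable_PiM_single') (auto simp: case_prod_unfold cong: measurable_cong_sets)
  with 0 show ?case by (simp add: unused_Nil)
next
  case (Suc n)
  then obtain y r where q: "q = y # r" "y \<le> n" and r: "r \<in> histories n"
    by (elim histories_SucE)
  note [measurable] = Suc.IH[OF r]
  have sub: "next_clock r ` ({..length r} - {y}) \<subseteq> unused r"
    using next_clock_unused[OF r] histories_length[OF r] by auto
  have "(\<lambda>w. residual (path w) r (next_clock r y)) \<in> borel_measurable M"
    using measurable_compose[OF Suc.IH[OF r] measurable_component_singleton[OF next_clock_unused[OF r q(2)]]]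
    by (simp cong: measurable_cong_sets)
  note lower = measurable_lower_on[OF sub this Suc.IH[OF r]]
  have "(\<lambda>z. restrict z (unused (y # r))) \<in> exp_product (unused r) \<rightarrow>\<^sub>M exp_product (unused (y # r))"
    by (rule measurable_restrict_subset) (auto simp: unused_Cons)
  from measurable_compose[OF lower this] show ?case
    unfolding q(1) residual.simps .
qed

text \<open>The factor \<open>exp (- s \<tau>)\<close>, where \<open>\<tau>\<close> is the birth time of the last individual, only serves
  to rule out explosion.\<close>

lemma nn_integral_residual:
  assumes "q \<in> histories n" "0 \<le> s" "G \<in> borel_measurable (exp_product (unused q))"
  shows "(\<integral>\<^sup>+w. (if follows (path w) q
        then ennreal (exp (- (s * birth_time (path w) (people q ! n)))) * G (residual (path w) q) else 0) \<partial>M)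
    = ennreal (\<Prod>k=1..n. 1 / (real k + s)) * (\<integral>\<^sup>+z. G z \<partial>exp_product (unused q))"
  using assms(1,3)
proof (induction n arbitrary: q G)
  case 0
  then have "q = []" by simp
  have "(\<integral>\<^sup>+z. G z \<partial>exp_product UNIV) = (\<integral>\<^sup>+w. G (\<lambda>(u, k). E u k w) \<partial>M)"
  proof (subst clocks_law[symmetric], rule nn_integral_distr)
    show "(\<lambda>w (u, k). E u k w) \<in> M \<rightarrow>\<^sub>M exp_product UNIV"
      using measurable_residual[of "[]" 0] by (simp add: unused_Nil)
  qed (use 0 \<open>q = []\<close> in \<open>simp add: unused_Nil\<close>)
  then show ?case using \<open>q = []\<close> by (simp add: unused_Nil)
next
  case (Suc n)
  then obtain y r where q: "q = y # r" "y \<le> n" and r: "r \<in> histories n"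
    by (elim histories_SucE)
  have len: "length r = n" using r by (rule histories_length)
  define f F J where "f = next_clock r y" and "F = next_clock r ` ({..n} - {y})" and "J = unused q"
  have J: "unused r = insert f J" "f \<notin> J"
    using next_clock_unused[OF r q(2)] by (auto simp: J_def q unused_Cons f_def)
  have F: "finite F" "F \<subseteq> J"
    using next_clock_unused[OF r] next_clock_eq_iff[OF r] q(2)
    by (auto simp: F_def J_def q unused_Cons)
  have card: "card F = n"
    unfolding F_def using next_clock_eq_iff[OF r] q(2)
    by (subst card_image) (auto simp: inj_on_def)
  note [measurable] = Suc.prems(2)[folded J_def]
  \<comment> \<open>\<open>H\<close> turns the race won by \<open>y\<close> into a function of the
    residual clocks of \<open>r\<close>, to which the induction hypothesis applies; this is why
    \<open>G\<close> is arbitrary in the induction.\<close>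
  define H where "H z = (if \<forall>v\<in>F. z f < z v
     then ennreal (exp (- (s * z f))) * G (restrict (lower_on F (z f) z) J) else 0)" for z
  have [measurable]: "Measurable.pred (exp_product (insert f J)) (\<lambda>z. \<forall>v\<in>F. z f < z v)"
    using F by (intro pred_intros_finite; measurable; auto)
  have [measurable]: "(\<lambda>z. lower_on F (z f) z) \<in> exp_product (insert f J) \<rightarrow>\<^sub>M exp_product (insert f J)"
    by (rule measurable_lower_on) (use F in auto)
  have [measurable]: "(\<lambda>z. restrict z J) \<in> exp_product (insert f J) \<rightarrow>\<^sub>M exp_product J"
    by (rule measurable_restrict_subset) auto
  have H: "H \<in> borel_measurable (exp_product (unused r))"
    unfolding J H_def by measurable
  \<comment> \<open>The new birth time is the old one plus the duration of the race, so the
    exponential factor splits.\<close>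
  have bt: "birth_time (path w) (people q ! Suc n) =
      birth_time (path w) (people r ! n) + residual (path w) r f" for w
    using residual_next_clock[OF r q(2)] q len by (simp add: nth_people_Cons f_def)
  have "(\<integral>\<^sup>+w. (if follows (path w) q
        then ennreal (exp (- (s * birth_time (path w) (people q ! Suc n)))) * G (residual (path w) q) else 0) \<partial>M)
     = (\<integral>\<^sup>+w. (if follows (path w) r
        then ennreal (exp (- (s * birth_time (path w) (people r ! n)))) * H (residual (path w) r) else 0) \<partial>M)"
  proof (rule nn_integral_cong)
    fix w
    have "residual (path w) q = restrict (lower_on F (residual (path w) r f) (residual (path w) r)) J"
      by (simp add: q F_def J_def f_def len)
    moreover have "follows (path w) q \<longleftrightarrow> follows (path w) r \<and>
        (\<forall>v\<in>F. residual (path w) r f < residual (path w) r v)"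
      using follows_Cons_residual[OF r q(2), of "path w"] unfolding q(1) f_def F_def .
    ultimately show "(if follows (path w) q
        then ennreal (exp (- (s * birth_time (path w) (people q ! Suc n)))) * G (residual (path w) q) else 0)
     = (if follows (path w) r
        then ennreal (exp (- (s * birth_time (path w) (people r ! n)))) * H (residual (path w) r) else 0)"
      by (auto simp: H_def bt mult.assoc[symmetric] ennreal_mult'[symmetric] exp_add[symmetric]
          algebra_simps)
  qed
  also have "\<dots> = ennreal (\<Prod>k=1..n. 1 / (real k + s)) * (\<integral>\<^sup>+z. H z \<partial>exp_product (unused r))"
    using r H by (rule Suc.IH)
  also have "(\<integral>\<^sup>+z. H z \<partial>exp_product (unused r))
      = ennreal (1 / (1 + real n + s)) * (\<integral>\<^sup>+z. G z \<partial>exp_product J)"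
    unfolding J H_def using exp_product_race[OF F J(2) assms(2), of G] card by simp
  finally show ?case
    using assms(2)
    by (simp add: J_def mult.assoc[symmetric] ennreal_mult'[symmetric] add.commute prod_nonneg)
qed

lemma nn_integral_follows_exp:
  assumes "q \<in> histories n" "0 \<le> s"
  shows "(\<integral>\<^sup>+w. (if follows (path w) q
        then ennreal (exp (- (s * birth_time (path w) (people q ! n)))) else 0) \<partial>M)
    = ennreal (\<Prod>k=1..n. 1 / (real k + s))"
proof -
  have "(\<integral>\<^sup>+z. 1 \<partial>exp_product (unused q)) = 1"
    using prob_space.emeasure_space_1[OF prob_space_exp_product, of "unused q"] by simp
  then show ?thesis
    using nn_integral_residual[OF assms, of "\<lambda>_. 1"] by (simp only: mult_1_right) simp
qed

text \<open>At \<open>s = 0\<close> the races contribute the factors \<open>1 / k\<close>, whoever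
  wins. The value is the same for all \<open>n!\<close> histories, which turns probabilities into
  counts.\<close>

lemma prob_follows:
  assumes "q \<in> histories n"
  shows "prob {w\<in>space M. follows (path w) q} = 1 / fact n"
proof -
  have "emeasure M {w\<in>space M. follows (path w) q}
     = (\<integral>\<^sup>+w. indicator {w\<in>space M. follows (path w) q} w \<partial>M)"
    by simp
  also have "\<dots> = (\<integral>\<^sup>+w. (if follows (path w) q then ennreal (exp (- (0 * birth_time (path w) (people q ! n)))) else 0) \<partial>M)"
    by (intro nn_integral_cong) (auto simp: indicator_def)
  also have "\<dots> = ennreal (\<Prod>k=1..n. 1 / (real k + 0))"
    using assms by (intro nn_integral_follows_exp) auto
  also have "(\<Prod>k=1..n. 1 / (real k + 0)) = 1 / fact n"
    by (simp add: prod_dividef fact_prod)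
  finally show ?thesis by (simp add: measure_def)
qed

lemma prob_follows_set:
  assumes "Q \<subseteq> histories n"
  shows "prob {w\<in>space M. \<exists>q\<in>Q. follows (path w) q} = real (card Q) / fact n"
proof -
  have fin: "finite Q" using assms finite_histories finite_subset by blast
  have "{w\<in>space M. \<exists>q\<in>Q. follows (path w) q} = (\<Union>q\<in>Q. {w\<in>space M. follows (path w) q})"
    by auto
  also have "prob \<dots> = (\<Sum>q\<in>Q. prob {w\<in>space M. follows (path w) q})"
    using assms fin by (intro finite_measure_finite_Union)
      (auto simp: disjoint_family_on_def dest: follows_unique subsetD)
  also have "\<dots> = (\<Sum>q\<in>Q. 1 / fact n)"
    using assms by (intro sum.cong prob_follows) auto
  finally show ?thesis by simp
qed

lemma AE_follows: "AE w in M. \<forall>n. \<exists>q\<in>histories n. follows (path w) q"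
proof (rule AE_all_countable[THEN iffD2], rule allI)
  fix n
  have "prob {w\<in>space M. \<exists>q\<in>histories n. follows (path w) q} = 1"
    using prob_follows_set[of "histories n" n] by (simp add: card_histories)
  from AE_prob_1[OF this] show "AE w in M. \<exists>q\<in>histories n. follows (path w) q"
    by eventually_elim auto
qed

lemma AE_clocks_pos: "AE w in M. \<forall>u k. 0 < path w u k"
proof -
  have "AE w in M. 0 < E u k w" for u k
  proof -
    have "\<P>(w in M. 0 < E u k w) = 1"
      using exponential_distributedD_gt[OF clocks_exponential, of 0 u k] by simp
    from AE_prob_1[OF this] show ?thesis by eventually_elim auto
  qed
  then show ?thesis by (simp add: AE_all_countable)
qed

text \<open>Markov's inequality for the exponential of minus the birth time, that is,
  \<open>s = 1\<close>: each of the \<open>n!\<close> histories carries mean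
  \<open>1 / (n + 1)!\<close>, which leaves \<open>1 / (n + 1)\<close> after summation.\<close>

lemma emeasure_follows_early:
  assumes "0 \<le> t"
  shows "emeasure M {w\<in>space M. \<exists>q\<in>histories n. follows (path w) q \<and> birth_time (path w) (people q ! n) \<le> t}
     \<le> ennreal (exp t / real (Suc n))"
proof -
  let ?A = "\<lambda>q. {w\<in>space M. follows (path w) q \<and> birth_time (path w) (people q ! n) \<le> t}"
  let ?f = "\<lambda>q w. if follows (path w) q
        then ennreal (exp (- (1 * birth_time (path w) (people q ! n)))) else 0"
  have "(\<Prod>k=1..n. 1 / (real k + 1)) = 1 / fact (Suc n)" for n
    by (induction n) (auto simp: field_simps)
  note prod = this
  have "emeasure M (?A q) \<le> ennreal (exp t / fact (Suc n))" if q: "q \<in> histories n" for q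
  proof -
    have "emeasure M (?A q) = (\<integral>\<^sup>+w. indicator (?A q) w \<partial>M)" by simp
    also have "\<dots> \<le> (\<integral>\<^sup>+w. ennreal (exp t) * ?f q w \<partial>M)"
      by (intro nn_integral_mono) (auto simp: indicator_def ennreal_mult'[symmetric] exp_add[symmetric])
    also have "\<dots> = ennreal (exp t) * (\<integral>\<^sup>+w. ?f q w \<partial>M)"
      by (rule nn_integral_cmult) measurable
    also have "(\<integral>\<^sup>+w. ?f q w \<partial>M) = ennreal (1 / fact (Suc n))"
      using nn_integral_follows_exp[OF q, of 1] prod by simp
    finally show ?thesis by (simp add: ennreal_mult'[symmetric])
  qed
  note A = this
  have "{w\<in>space M. \<exists>q\<in>histories n. follows (path w) q \<and> birth_time (path w) (people q ! n) \<le> t}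
     = (\<Union>q\<in>histories n. ?A q)" by auto
  also have "emeasure M \<dots> \<le> (\<Sum>q\<in>histories n. emeasure M (?A q))"
    by (rule emeasure_subadditive_finite) auto
  also have "\<dots> \<le> (\<Sum>q\<in>histories n. ennreal (exp t / fact (Suc n)))"
    by (intro sum_mono A)
  also have "\<dots> = ennreal (fact n * (exp t / fact (Suc n)))"
    by (simp add: card_histories ennreal_mult'[symmetric] ennreal_of_nat_eq_real_of_nat)
  also have "fact n * (exp t / fact (Suc n)) = exp t / real (Suc n)"
    by simp
  finally show ?thesis .
qed

lemma AE_no_explosion:
  "AE w in M. \<forall>t. \<exists>n. \<forall>q\<in>histories n. follows (path w) q \<longrightarrow> t < birth_time (path w) (people q ! n)"
proof -
  \<comment> \<open>Integer horizons suffice, and their countably many null sets may be discarded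
    together.\<close>
  have "AE w in M. \<exists>n. \<forall>q\<in>histories n. follows (path w) q \<longrightarrow> real T < birth_time (path w) (people q ! n)" for T :: nat
  proof -
    define B where "B n = {w\<in>space M. \<exists>q\<in>histories n. follows (path w) q \<and> birth_time (path w) (people q ! n) \<le> real T}" for n
    have [measurable]: "B n \<in> sets M" for n
      unfolding B_def by (rule sets.sets_Collect_finite_Ex) auto
    have le: "emeasure M (\<Inter>n. B n) \<le> ennreal (exp (real T) / real (Suc n))" for n
    proof -
      have "emeasure M (\<Inter>n. B n) \<le> emeasure M (B n)"
        by (rule emeasure_mono) auto
      also have "\<dots> \<le> ennreal (exp (real T) / real (Suc n))"
        unfolding B_def by (rule emeasure_follows_early) simp
      finally show ?thesis .
    qed
    have "(\<lambda>n. ennreal (exp (real T) / real (Suc n))) \<longlonglongrightarrow> ennreal 0"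
      by (intro tendsto_ennrealI LIMSEQ_Suc[OF lim_const_over_n])
    then have "emeasure M (\<Inter>n. B n) \<le> ennreal 0"
      by (rule LIMSEQ_le_const) (use le in blast)
    then have "(\<Inter>n. B n) \<in> null_sets M" by (intro null_setsI) auto
    then show ?thesis by (rule AE_I') (auto simp: not_less B_def)
  qed
  then have "AE w in M. \<forall>T::nat. \<exists>n. \<forall>q\<in>histories n. follows (path w) q \<longrightarrow> real T < birth_time (path w) (people q ! n)"
    by (simp add: AE_all_countable)
  then show ?thesis
  proof eventually_elim
    case (elim w)
    show ?case
    proof
      fix t :: real
      obtain T :: nat where "t < real T" using reals_Archimedean2 by blast
      with elim show "\<exists>n. \<forall>q\<in>histories n. follows (path w) q \<longrightarrow> t < birth_time (path w) (people q ! n)"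
        by (meson order_less_trans)
    qed
  qed
qed

end


section \<open>The collapsed process along a history\<close>

text \<open>The almost sure properties behind all pathwise statements: positive clocks, a strict
  winner in each race, no explosion. On such realisations the genealogy is handled
  deterministically.\<close>

definition regular :: "(nat list \<Rightarrow> nat \<Rightarrow> real) \<Rightarrow> bool" where
  "regular e \<longleftrightarrow> (\<forall>u k. 0 < e u k) \<and> (\<forall>n. \<exists>q\<in>histories n. follows e q) \<and>
     (\<forall>t. \<exists>n. \<forall>q\<in>histories n. follows e q \<longrightarrow> t < birth_time e (people q ! n))"

lemma (in unit_birth_clocks) AE_regular: "AE w in M. regular (path w)"
  using AE_clocks_pos AE_follows AE_no_explosion
  by eventually_elim (simp add: regular_def)

definition history :: "(nat list \<Rightarrow> nat \<Rightarrow> real) \<Rightarrow> nat \<Rightarrow> nat list" where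
  "history e n = (THE q. q \<in> histories n \<and> follows e q)"

lemma history_eqI: "q \<in> histories n \<Longrightarrow> follows e q \<Longrightarrow> history e n = q"
  unfolding history_def by (rule the_equality) (auto intro: follows_unique)

text \<open>The in-degree of vertex \<open>b + 1\<close>, loops included, read off the
  history.\<close>

definition block_degree :: "nat \<Rightarrow> nat list \<Rightarrow> nat \<Rightarrow> nat" where
  "block_degree m q b = count_list (map (\<lambda>p. p div m) q) b"

lemma sum_count_list_block:
  assumes "0 < m"
  shows "(\<Sum>j=1..m. count_list q (m * b + j - 1)) = block_degree m q b"
proof (induction q)
  case (Cons p q)
  have "(\<Sum>j=1..m. if p = m * b + j - 1 then 1 else 0) = (if p div m = b then 1 else (0::nat))"
  proof (cases "p div m = b")
    case True
    have p: "p = m * b + p mod m" using True mult_div_mod_eq[of m p] by simp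
    have "p = m * b + j - 1 \<longleftrightarrow> j = Suc (p mod m)" if "j \<in> {1..m}" for j
    proof -
      obtain i where "j = Suc i" using \<open>j \<in> {1..m}\<close> by (cases j) auto
      then show ?thesis using p by (metis add_Suc_right add_left_cancel diff_Suc_1)
    qed
    then have "(\<Sum>j=1..m. if p = m * b + j - 1 then 1 else 0) =
        (\<Sum>j=1..m. if j = Suc (p mod m) then 1 else (0::nat))"
      by (intro sum.cong) auto
    also have "\<dots> = 1" using assms by (simp add: Suc_le_eq)
    finally show ?thesis using True by simp
  next
    case False
    have "p \<noteq> m * b + j - 1" if "j \<in> {1..m}" for j
    proof
      assume "p = m * b + j - 1"
      then have "p = m * b + (j - 1)" "j - 1 < m" using that by auto
      then have "p div m = b" by simp
      with False show False by simp
    qed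
    then show ?thesis using False by (auto intro!: sum.neutral)
  qed
  moreover have "(\<Sum>j=1..m. count_list (p # q) (m * b + j - 1)) =
      (\<Sum>j=1..m. (if p = m * b + j - 1 then 1 else 0) + count_list q (m * b + j - 1))"
    by (intro sum.cong) auto
  ultimately have "(\<Sum>j=1..m. count_list (p # q) (m * b + j - 1)) =
      (if p div m = b then 1 else 0) + (\<Sum>j=1..m. count_list q (m * b + j - 1))"
    by (simp only: sum.distrib)
  then show ?case using Cons.IH by (simp add: block_degree_def)
qed (simp add: block_degree_def)

text \<open>Mirrors \<open>CBP\<close> at the birth of the last individual. Labels count from 1,
  histories from 0 with the latest entry in front, hence the position
  \<open>Suc (length q) - idx m x j\<close>; the guard \<open>2 \<le> idx m x j\<close> excludes the
  first individual, which has no parent.\<close>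

definition history_graph :: "nat \<Rightarrow> nat list \<Rightarrow> multigraph" where
  "history_graph m q =
     \<lparr> vertices = {v. 1 \<le> v \<and> idx m v 1 \<le> Suc (length q)},
       edge_count = (\<lambda>x y. if 1 \<le> x \<and> 1 \<le> y
          then card {j \<in> {1..m}. idx m x j \<le> Suc (length q) \<and>
            (\<exists>l\<in>{1..m}. 2 \<le> idx m x j \<and> q ! (Suc (length q) - idx m x j) = idx m y l - 1)} else 0) \<rparr>"

definition history_fraction :: "nat \<Rightarrow> nat \<Rightarrow> nat list \<Rightarrow> real" where
  "history_fraction m k q =
     real (card {b. b \<le> length q div m \<and> block_degree m q b = k}) / real (Suc (length q div m))"

section \<open>The process on a regular realisation\<close>

context
  fixes e :: "nat list \<Rightarrow> nat \<Rightarrow> real"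
  assumes reg: "regular e"
begin

lemma clock_pos: "0 < e u k"
  using reg by (simp add: regular_def)

lemma history_props: "history e n \<in> histories n" "follows e (history e n)"
proof -
  obtain q where "q \<in> histories n" "follows e q"
    using reg unfolding regular_def by blast
  then show "history e n \<in> histories n" "follows e (history e n)"
    using history_eqI by auto
qed

lemma length_history [simp]: "length (history e n) = n"
  using history_props(1) by (rule histories_length)

lemma history_Suc: "\<exists>y\<le>n. history e (Suc n) = y # history e n"
proof -
  obtain y q where q: "history e (Suc n) = y # q" "y \<le> n" "q \<in> histories n"
    using history_props(1)[of "Suc n"] by (elim histories_SucE)
  moreover have "follows e q"
    using history_props(2)[of "Suc n"] q by simp
  ultimately show ?thesis
    using history_eqI by auto
qed

lemma individual_history: "x \<le> n \<Longrightarrow> individual e (Suc x) = people (history e n) ! x"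
  by (rule individual_follows[OF clock_pos history_props])

lemma tau_history: "x \<le> n \<Longrightarrow> tau e (Suc x) = birth_time e (people (history e n) ! x)"
  by (simp add: tau_def individual_history)

lemma tau_Suc_Suc:
  assumes "history e (Suc n) = y # history e n"
  shows "tau e (Suc (Suc n)) = birth_time e (next_child (history e n) y)"
  using tau_history[of "Suc n" "Suc n"] by (simp add: assms nth_people_Cons)

lemma strict_mono_tau: "strict_mono (\<lambda>n. tau e (Suc n))"
proof (rule strict_mono_Suc_iff[THEN iffD2], rule allI)
  fix n
  obtain y where y: "y \<le> n" "history e (Suc n) = y # history e n"
    using history_Suc by blast
  show "tau e (Suc n) < tau e (Suc (Suc n))"
    using next_child_later[OF clock_pos history_props y(1)] tau_Suc_Suc[OF y(2)] tau_history[of n n]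
    by simp
qed

lemma tau_le_iff: "1 \<le> x \<Longrightarrow> 1 \<le> y \<Longrightarrow> tau e x \<le> tau e y \<longleftrightarrow> x \<le> y"
  using strict_mono_less_eq[OF strict_mono_tau, of "x - 1" "y - 1"] by (simp add: le_diff_iff)

lemma tau_unbounded: "\<exists>n. t < tau e (Suc n)"
proof -
  obtain n where "\<forall>q\<in>histories n. follows e q \<longrightarrow> t < birth_time e (people q ! n)"
    using reg unfolding regular_def by blast
  then have "t < birth_time e (people (history e n) ! n)" using history_props by blast
  then show ?thesis using tau_history[of n n] by (intro exI[of _ n]) simp
qed

lemma is_parent_history:
  assumes "x \<le> n"
  shows "is_parent e (Suc y) (Suc x) \<longleftrightarrow> 1 \<le> x \<and> history e n ! (n - x) = y"
proof -
  have drop: "history e (n + d) ! (n + d - x) = history e n ! (n - x)" for d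
  proof (induction d)
    case (Suc d)
    obtain z where "history e (Suc (n + d)) = z # history e (n + d)"
      using history_Suc by blast
    with Suc assms show ?case by (simp add: Suc_diff_le)
  qed simp
  \<comment> \<open>Individual \<open>y\<close> may be absent from the history of length
    \<open>n\<close>, so the question is moved to a longer history, whose older entries are
    unchanged.\<close>
  define N where "N = n + y"
  have "is_parent e (Suc y) (Suc x) \<longleftrightarrow> (\<exists>c. people (history e N) ! x = c # people (history e N) ! y)"
    using assms by (simp add: is_parent_def individual_history[of _ N] N_def)
  also have "\<dots> \<longleftrightarrow> 1 \<le> x \<and> history e N ! (N - x) = y"
    using assms by (intro people_child_iff[OF history_props(1)]) (auto simp: N_def)
  finally show ?thesis by (simp add: N_def drop)
qed

lemma CBP_history:
  assumes "0 < m"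
  shows "CBP m e (tau e (Suc n)) = history_graph m (history e n)"
proof -
  have idx: "1 \<le> idx m v j" if "1 \<le> j" for v j using that by (simp add: idx_def)
  have tau: "tau e (idx m v j) \<le> tau e (Suc n) \<longleftrightarrow> idx m v j \<le> Suc n" if "1 \<le> j" for v j
    using idx[OF that] by (intro tau_le_iff) auto
  have V: "{v. 1 \<le> v \<and> tau e (idx m v 1) \<le> tau e (Suc n)} = {v. 1 \<le> v \<and> idx m v 1 \<le> Suc n}"
    by (simp add: tau)
  have J: "{j \<in> {1..m}. tau e (idx m x j) \<le> tau e (Suc n) \<and> edge_event m e x j y} =
     {j \<in> {1..m}. idx m x j \<le> Suc n \<and>
       (\<exists>l\<in>{1..m}. 2 \<le> idx m x j \<and> history e n ! (Suc n - idx m x j) = idx m y l - 1)}" for x y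
  proof -
    have "edge_event m e x j y \<longleftrightarrow>
        (\<exists>l\<in>{1..m}. 2 \<le> idx m x j \<and> history e n ! (Suc n - idx m x j) = idx m y l - 1)"
      if "j \<in> {1..m}" "idx m x j \<le> Suc n" for j
    proof -
      have "is_parent e (idx m y l) (idx m x j) \<longleftrightarrow>
          2 \<le> idx m x j \<and> history e n ! (Suc n - idx m x j) = idx m y l - 1" if "l \<in> {1..m}" for l
        using is_parent_history[of "idx m x j - 1" n "idx m y l - 1"] idx[of j x] idx[of l y] that
          \<open>j \<in> {1..m}\<close> \<open>idx m x j \<le> Suc n\<close> by auto
      then show ?thesis by (auto simp: edge_event_def)
    qed
    then show ?thesis using tau by auto
  qed
  show ?thesis
    unfolding CBP_def history_graph_def length_history V J ..
qed

text \<open>Each jump is the birth of a child. By time \<open>t\<close> the last counted child is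
  born, and the next one is not, since even the earliest of all candidates is born after
  \<open>t\<close>.\<close>

lemma birth_process_history:
  assumes "x \<le> n" "tau e (Suc n) \<le> t" "t < tau e (Suc (Suc n))"
  shows "birth_process (e (individual e (Suc x))) (t - tau e (Suc x)) = count_list (history e n) x"
proof -
  define q u c where "q = history e n" and "u = people q ! x" and "c = count_list q x"
  have ind: "individual e (Suc x) = u" and tau: "tau e (Suc x) = birth_time e u"
    using assms(1) by (simp_all add: u_def q_def individual_history tau_history)
  have tx: "tau e (Suc x) \<le> t"
    using tau_le_iff[of "Suc x" "Suc n"] assms by simp
  have lower: "(\<Sum>i<c. e u i) \<le> t - birth_time e u"
  proof (cases c)
    case (Suc d)
    then have "d # u \<in> set (people q)"
      using child_in_people_iff[OF history_props(1)[of n] assms(1), of d] by (simp add: q_def u_def c_def)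
    then obtain z where z: "z \<le> n" "people q ! z = d # u"
      by (auto simp: in_set_conv_nth q_def less_Suc_eq_le)
    have "birth_time e (d # u) \<le> t"
      using tau_history[OF z(1)] z tau_le_iff[of "Suc z" "Suc n"] assms(2) by (simp add: q_def)
    then show ?thesis by (simp add: Suc lessThan_Suc_atMost)
  qed (use tx tau in simp)
  obtain y where y: "y \<le> n" "history e (Suc n) = y # q"
    using history_Suc q_def by blast
  have "t < birth_time e (next_child q x)"
  proof (cases "x = y")
    case True
    then show ?thesis using tau_Suc_Suc y assms(3) by (simp add: q_def)
  next
    case False
    have "follows e (y # q)" using history_props(2)[of "Suc n"] y by simp
    then have "birth_time e (next_child q y) < birth_time e (next_child q x)"
      using False assms(1) by (simp add: q_def)
    moreover have "t < birth_time e (next_child q y)"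
      using tau_Suc_Suc y assms(3) by (simp add: q_def)
    ultimately show ?thesis by simp
  qed
  then have upper: "t - birth_time e u < (\<Sum>i\<le>c. e u i)"
    by (simp add: next_child_def u_def c_def)
  have "(LEAST k. t - birth_time e u \<in> {(\<Sum>i<k. e u i) ..< (\<Sum>i\<le>k. e u i)}) = c"
  proof (rule Least_equality)
    fix k assume k: "t - birth_time e u \<in> {(\<Sum>i<k. e u i) ..< (\<Sum>i\<le>k. e u i)}"
    show "c \<le> k"
    proof (rule ccontr)
      assume "\<not> c \<le> k"
      then have "(\<Sum>i\<le>k. e u i) \<le> (\<Sum>i<c. e u i)"
        using clock_pos by (intro sum_mono2) (auto intro: less_imp_le)
      with k lower show False by simp
    qed
  qed (use lower upper in auto)
  then show ?thesis
    using tx by (simp add: birth_process_def ind tau c_def q_def)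
qed

lemma in_degree_history:
  assumes "0 < m" "tau e (Suc n) \<le> t" "t < tau e (Suc (Suc n))"
  shows "in_degree m e (Suc b) t = block_degree m (history e n) b"
proof -
  have "in_degree m e (Suc b) t = (\<Sum>j=1..m. count_list (history e n) (m * b + j - 1))"
    unfolding in_degree_def
  proof (intro sum.cong refl)
    fix j assume j: "j \<in> {1..m}"
    then have idx: "idx m (Suc b) j = Suc (m * b + j - 1)" by (simp add: idx_def)
    show "birth_process (e (individual e (idx m (Suc b) j))) (t - tau e (idx m (Suc b) j)) =
        count_list (history e n) (m * b + j - 1)"
    proof (cases "m * b + j - 1 \<le> n")
      case True
      then show ?thesis unfolding idx by (rule birth_process_history[OF _ assms(2,3)])
    next
      \<comment> \<open>An unborn individual has negative age, where \<open>birth_process\<close> is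
        0 by convention.\<close>
      case False
      then have "t < tau e (Suc (m * b + j - 1))"
        using assms(3) tau_le_iff[of "Suc (Suc n)" "Suc (m * b + j - 1)"] by simp
      moreover have "count_list (history e n) (m * b + j - 1) = 0"
        using False by (intro histories_count_eq_0[OF history_props(1)]) simp
      ultimately show ?thesis unfolding idx by (simp add: birth_process_def)
    qed
  qed
  also have "\<dots> = block_degree m (history e n) b"
    using assms(1) by (rule sum_count_list_block)
  finally show ?thesis .
qed

lemma degree_fraction_history:
  assumes "0 < m" "tau e (Suc n) \<le> t" "t < tau e (Suc (Suc n))"
  shows "degree_fraction m e k t = history_fraction m k (history e n)"
proof -
  have "tau e (idx m v 1) \<le> t \<longleftrightarrow> idx m v 1 \<le> Suc n" for v
    using tau_le_iff[of "idx m v 1" "Suc n"] tau_le_iff[of "Suc (Suc n)" "idx m v 1"] assms(2,3)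
    by (auto simp: idx_def)
  then have V: "v \<in> vertices (CBP m e t) \<longleftrightarrow> 1 \<le> v \<and> idx m v 1 \<le> Suc n" for v
    by (simp add: CBP_def)
  have "v \<in> vertices (CBP m e t) \<longleftrightarrow> v \<in> Suc ` {..n div m}" for v
    using assms(1)
    by (cases v) (auto simp: V idx_def less_eq_div_iff_mult_less_eq mult.commute)
  then have V: "vertices (CBP m e t) = Suc ` {..n div m}" by blast
  have "{v \<in> vertices (CBP m e t). in_degree m e v t = k} =
      Suc ` {b. b \<le> n div m \<and> block_degree m (history e n) b = k}"
    unfolding V using in_degree_history[OF assms] by auto
  then show ?thesis
    unfolding degree_fraction_def num_vertices_def num_vertices_deg_def history_fraction_def V
    by (simp add: card_image)
qed

lemma history_at_time:
  assumes "tau e (Suc N) \<le> t"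
  obtains n where "N \<le> n" "tau e (Suc n) \<le> t" "t < tau e (Suc (Suc n))"
proof -
  define n where "n = (LEAST n. t < tau e (Suc (Suc n)))"
  obtain k where "t < tau e (Suc k)" using tau_unbounded by blast
  then have "t < tau e (Suc (Suc k))"
    using strict_mono_tau by (meson lessI order_less_trans strict_mono_less)
  then have n: "t < tau e (Suc (Suc n))" unfolding n_def by (rule LeastI)
  have "tau e (Suc n) \<le> t"
  proof (cases n)
    case 0
    then show ?thesis using assms tau_le_iff[of "Suc 0" "Suc N"] by simp
  next
    case (Suc l)
    then show ?thesis using not_less_Least[of l "\<lambda>n. t < tau e (Suc (Suc n))"] by (simp add: n_def)
  qed
  moreover have "N \<le> n"
    using n assms tau_le_iff[of "Suc (Suc n)" "Suc N"] by linarith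
  ultimately show ?thesis using that n by blast
qed

end


section \<open>Mean square estimates\<close>

text \<open>The number of individuals, rather than of vertices, whose vertex has degree \<open>k\<close>: the next
  parent belongs to such a vertex with conditional probability exactly \<open>members_of_degree m k q\<close>
  divided by the number of individuals.\<close>

definition members_of_degree :: "nat \<Rightarrow> nat \<Rightarrow> nat list \<Rightarrow> real" where
  "members_of_degree m k q = (\<Sum>x\<le>length q. of_bool (block_degree m q (x div m) = k))"

definition limit_degree :: "nat \<Rightarrow> nat \<Rightarrow> real" where
  "limit_degree m k = 1 / (real m + 1) * (real m / (real m + 1)) ^ k"

definition deviation :: "nat \<Rightarrow> nat \<Rightarrow> nat list \<Rightarrow> real" where
  "deviation m k q = members_of_degree m k q - limit_degree m k * real (Suc (length q))"

lemma sum_of_bool_atMost: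
  "(\<Sum>x\<le>n. of_bool (P x)) = of_nat (card {x. x \<le> n \<and> P x})" for n :: nat
proof -
  have "{..n} \<inter> {x. P x} = {x. x \<le> n \<and> P x}" by auto
  then show ?thesis by (simp add: sum_of_bool_eq)
qed

text \<open>By \<open>prob_follows\<close> this is the expectation of \<open>f\<close> at the random
  history.\<close>

definition history_mean :: "nat \<Rightarrow> (nat list \<Rightarrow> real) \<Rightarrow> real" where
  "history_mean n f = (\<Sum>q\<in>histories n. f q) / fact n"

lemma history_mean_Suc:
  "history_mean (Suc n) f = history_mean n (\<lambda>q. (\<Sum>y\<le>n. f (y # q)) / real (Suc n))"
  unfolding history_mean_def sum_histories_Suc by (simp add: sum_divide_distrib field_simps)

lemma history_mean_mono:
  "(\<And>q. q \<in> histories n \<Longrightarrow> f q \<le> g q) \<Longrightarrow> history_mean n f \<le> history_mean n g"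
  unfolding history_mean_def by (intro divide_right_mono sum_mono) auto

lemma history_mean_add: "history_mean n (\<lambda>q. f q + g q) = history_mean n f + history_mean n g"
  by (simp add: history_mean_def sum.distrib add_divide_distrib)

lemma history_mean_cmult: "history_mean n (\<lambda>q. c * f q) = c * history_mean n f"
  by (simp add: history_mean_def sum_distrib_left)

lemma history_mean_const: "history_mean n (\<lambda>q. c) = c"
  by (simp add: history_mean_def card_histories)

lemma block_degree_Cons:
  "block_degree m (y # q) b = block_degree m q b + of_bool (y div m = b)"
  by (simp add: block_degree_def)

text \<open>The balance of one birth in the limit: the newcomer brings one individual of degree 0,
  and a vertex that receives an edge moves its \<open>m\<close> members up by one degree.\<close>

lemma limit_degree_balance:
  "of_bool (k = 0) = limit_degree m k +
     real m * (limit_degree m k - (if k = 0 then 0 else limit_degree m (k - 1)))"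
proof (cases k)
  case 0
  then show ?thesis by (simp add: limit_degree_def field_simps)
next
  case (Suc l)
  have "limit_degree m (Suc l) * (real m + 1) = limit_degree m l * real m"
    by (simp add: limit_degree_def)
  then show ?thesis by (simp add: Suc algebra_simps)
qed

lemma limit_degree_bounds: "0 \<le> limit_degree m k" "limit_degree m k \<le> 1"
proof -
  show "0 \<le> limit_degree m k" by (simp add: limit_degree_def)
  have "(real m / (real m + 1)) ^ k \<le> 1" by (intro power_le_one) auto
  then have "1 / (real m + 1) * (real m / (real m + 1)) ^ k \<le> 1 * 1"
    by (intro mult_mono) auto
  then show "limit_degree m k \<le> 1" by (simp add: limit_degree_def)
qed

text \<open>The second bound serves the youngest vertex; truncated subtraction makes it 0 for a
  vertex that has not started.\<close>

lemma card_block_le: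
  assumes "0 < m"
  shows "card {x. x \<le> n \<and> x div m = b} \<le> m" "card {x. x \<le> n \<and> x div m = b} \<le> Suc n - m * b"
proof -
  have sub: "{x. x \<le> n \<and> x div m = b} \<subseteq> {m * b..<m * b + m} \<inter> {m * b..<Suc n}"
    using assms by (auto simp: dividend_less_times_div)
      (metis add.commute dividend_less_times_div mult.commute)
  have "card {x. x \<le> n \<and> x div m = b} \<le> card {m * b..<m * b + m}"
    using sub by (intro card_mono) auto
  then show "card {x. x \<le> n \<and> x div m = b} \<le> m" by simp
  have "card {x. x \<le> n \<and> x div m = b} \<le> card {m * b..<Suc n}"
    using sub by (intro card_mono) auto
  then show "card {x. x \<le> n \<and> x div m = b} \<le> Suc n - m * b" by simp
qed

lemma card_block_full:
  assumes "0 < m" "b < Suc n div m"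
  shows "card {x. x \<le> n \<and> x div m = b} = m"
proof -
  have le: "m * b + m \<le> Suc n"
    using assms by (metis Suc_le_eq less_eq_div_iff_mult_less_eq mult.commute mult_Suc_right add.commute)
  have "x \<le> n \<and> x div m = b \<longleftrightarrow> m * b \<le> x \<and> x < m * b + m" for x
  proof
    assume "m * b \<le> x \<and> x < m * b + m"
    then obtain r where "x = m * b + r" "r < m" by (metis add_less_cancel_left le_iff_add)
    then show "x \<le> n \<and> x div m = b" using le by simp
  next
    assume "x \<le> n \<and> x div m = b"
    then show "m * b \<le> x \<and> x < m * b + m"
      using mult_div_mod_eq[of m x] mod_less_divisor[OF assms(1), of x] by auto
  qed
  then have "{x. x \<le> n \<and> x div m = b} = {m * b..<m * b + m}"
    unfolding set_eq_iff mem_Collect_eq atLeastLessThan_iff by blast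
  then show ?thesis
    by (simp only: card_atLeastLessThan diff_add_inverse)
qed

text \<open>Two things change: the newcomer is counted at the degree of its own vertex, and all
  present members of the parent's vertex move up by one degree.\<close>

lemma members_of_degree_Cons:
  assumes "length q = n"
  shows "members_of_degree m k (y # q) - members_of_degree m k q =
     of_bool (block_degree m (y # q) (Suc n div m) = k) +
     real (card {x. x \<le> n \<and> x div m = y div m}) *
       (of_bool (Suc (block_degree m q (y div m)) = k) - of_bool (block_degree m q (y div m) = k))"
proof -
  let ?D = "\<lambda>x. block_degree m q (x div m)"
  have "(\<Sum>x\<le>n. of_bool (block_degree m (y # q) (x div m) = k) - of_bool (?D x = k)) =
    (\<Sum>x\<le>n. if x div m = y div m then of_bool (Suc (?D y) = k) - of_bool (?D y = k) else (0::real))"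
    by (intro sum.cong) (auto simp: block_degree_Cons)
  also have "\<dots> = real (card {x. x \<le> n \<and> x div m = y div m}) * (of_bool (Suc (?D y) = k) - of_bool (?D y = k))"
    by (subst sum.inter_filter[symmetric]) simp_all
  finally show ?thesis
    using assms by (simp add: members_of_degree_def sum_subtractf)
qed

lemma members_of_degree_bounds:
  "0 \<le> members_of_degree m k q" "members_of_degree m k q \<le> real (Suc (length q))"
proof -
  show "0 \<le> members_of_degree m k q"
    unfolding members_of_degree_def by (intro sum_nonneg) auto
  have "members_of_degree m k q \<le> (\<Sum>x\<le>length q. 1)"
    unfolding members_of_degree_def by (intro sum_mono) auto
  then show "members_of_degree m k q \<le> real (Suc (length q))" by simp
qed

lemma abs_deviation_le: "\<bar>deviation m k q\<bar> \<le> real (Suc (length q))"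
proof -
  define N P where "N = real (Suc (length q))" and "P = limit_degree m k * N"
  have "P \<le> 1 * N"
    unfolding P_def using limit_degree_bounds by (intro mult_right_mono) (auto simp: N_def)
  moreover have "0 \<le> P"
    unfolding P_def using limit_degree_bounds by (simp add: N_def)
  ultimately show ?thesis
    using members_of_degree_bounds[of m k q]
    unfolding deviation_def N_def[symmetric] P_def[symmetric] by linarith
qed

text \<open>At most \<open>m\<close> members move, one individual is added, and the centring shifts
  by \<open>limit_degree m k \<le> 1\<close>.\<close>

lemma deviation_Cons_le:
  assumes "0 < m"
  shows "\<bar>deviation m k (y # q) - deviation m k q\<bar> \<le> real m + 2"
proof -
  let ?s = "real (card {x. x \<le> length q \<and> x div m = y div m})"
  let ?d = "of_bool (Suc (block_degree m q (y div m)) = k) - of_bool (block_degree m q (y div m) = k) :: real"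
  have "\<bar>?s * ?d\<bar> \<le> real m * 1"
    unfolding abs_mult using card_block_le(1)[OF assms] by (intro mult_mono) auto
  moreover define u where "u = (of_bool (block_degree m (y # q) (Suc (length q) div m) = k) :: real)"
  moreover have "0 \<le> u" "u \<le> 1" by (simp_all add: u_def)
  moreover have "deviation m k (y # q) - deviation m k q = u + ?s * ?d - limit_degree m k"
    unfolding u_def members_of_degree_Cons[OF refl, of m k y, symmetric]
    by (simp add: deviation_def algebra_simps)
  ultimately show ?thesis
    using limit_degree_bounds[of m k] unfolding abs_le_iff mult_1_right by (simp only:) linarith
qed

text \<open>The vertex that the next individual joins has fewer than \<open>m\<close> members so
  far, and only the births since its start can hit it, each with probability
  \<open>O(1/n)\<close>.\<close>

lemma mean_last_block_degree:
  assumes "0 < m"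
  shows "real (Suc n) * history_mean n (\<lambda>q. real (block_degree m q (Suc n div m))) \<le> (real m)\<^sup>2"
proof -
  \<comment> \<open>The vertex \<open>b\<close> is kept fixed, as the youngest one changes with
    \<open>n\<close>. With \<open>j = Suc n - m * b\<close> the claim bounds the mean degree by
    \<open>j^2 / (n + 1)\<close>, written without division.\<close>
  have "Suc n * (\<Sum>q\<in>histories n. block_degree m q b) \<le> fact n * (Suc n - m * b)\<^sup>2" for b n
  proof (induction n)
    case 0
    then show ?case by (simp add: block_degree_def)
  next
    case (Suc n)
    define S s j where "S = (\<Sum>q\<in>histories n. block_degree m q b)"
      and "s = card {x. x \<le> n \<and> x div m = b}" and "j = Suc n - m * b"
    have "(\<Sum>q\<in>histories (Suc n). block_degree m q b) =
        (\<Sum>q\<in>histories n. \<Sum>y\<le>n. block_degree m q b + of_bool (y div m = b))"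
      unfolding sum_histories_Suc block_degree_Cons ..
    also have "\<dots> = (\<Sum>q\<in>histories n. Suc n * block_degree m q b + s)"
    proof (intro sum.cong refl)
      have "(\<Sum>y\<le>n. of_bool (y div m = b)) = s"
        by (simp add: s_def sum_of_bool_atMost)
      then show "(\<Sum>y\<le>n. block_degree m q b + of_bool (y div m = b)) = Suc n * block_degree m q b + s" for q
        by (simp add: sum.distrib)
    qed
    also have "\<dots> = Suc n * S + fact n * s"
      by (simp add: sum.distrib S_def sum_distrib_left[symmetric] card_histories)
    finally have eq: "(\<Sum>q\<in>histories (Suc n). block_degree m q b) = Suc n * S + fact n * s" .
    have s: "s \<le> j" unfolding s_def j_def by (rule card_block_le(2)[OF assms])
    have j: "j \<le> Suc n" by (simp add: j_def)
    \<comment> \<open>For \<open>j > 0\<close> the bound \<open>s \<le> j\<close> reduces this to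
      \<open>(n + 2) * j \<le> (n + 1) * (j + 1)\<close>, that is, to
      \<open>j \<le> n + 1\<close>.\<close>
    have "Suc (Suc n) * (j\<^sup>2 + s) \<le> Suc n * (Suc (Suc n) - m * b)\<^sup>2"
    proof (cases "j = 0")
      case True
      then show ?thesis using s by simp
    next
      case False
      then have "Suc (Suc n) - m * b = Suc j" by (simp add: j_def)
      moreover have "j * Suc j \<le> Suc n * Suc j" using j by (rule mult_right_mono) simp
      moreover have "Suc (Suc n) * (j\<^sup>2 + s) \<le> Suc (Suc n) * (j\<^sup>2 + j)"
        using s by (intro mult_left_mono) auto
      ultimately show ?thesis by (simp add: power2_eq_square algebra_simps)
    qed
    then have "fact n * (Suc (Suc n) * (j\<^sup>2 + s)) \<le> fact n * (Suc n * (Suc (Suc n) - m * b)\<^sup>2)"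
      by (rule mult_left_mono) simp
    moreover have "Suc (Suc n) * (Suc n * S) \<le> Suc (Suc n) * (fact n * j\<^sup>2)"
      using Suc.IH unfolding S_def j_def by (rule mult_left_mono) simp
    ultimately show ?case unfolding eq by (simp add: algebra_simps)
  qed
  \<comment> \<open>For this \<open>b\<close> the number \<open>j\<close> is
    \<open>Suc n mod m\<close>, which is below \<open>m\<close>.\<close>
  from this[of n "Suc n div m"]
  have "Suc n * (\<Sum>q\<in>histories n. block_degree m q (Suc n div m)) \<le> fact n * (Suc n mod m)\<^sup>2"
    by (simp add: minus_mult_div_eq_mod)
  also have "\<dots> \<le> fact n * m\<^sup>2"
    using assms by (intro mult_left_mono power_mono) (auto intro: less_imp_le)
  finally have "real (Suc n * (\<Sum>q\<in>histories n. block_degree m q (Suc n div m))) \<le> real (fact n * m\<^sup>2)"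
    by (simp only: of_nat_le_iff)
  then show ?thesis
    by (simp add: history_mean_def field_simps)
qed

text \<open>The drift of \<open>deviation m k\<close> is \<open>m / Suc n\<close> times the difference of the deviations at
  \<open>k - 1\<close> and \<open>k\<close>, up to an error that is due to the youngest, possibly incomplete, vertex.\<close>

lemma sum_deviation_Cons:
  fixes m n k :: nat
  assumes m: "0 < m" and q: "q \<in> histories n"
  defines "prev \<equiv> if k = 0 then 0 else deviation m (k - 1) q"
  shows "(\<Sum>y\<le>n. (deviation m k (y # q))\<^sup>2) \<le>
     real (Suc n) * (deviation m k q)\<^sup>2 + real m * prev\<^sup>2 +
     real (Suc n) * ((real m + 2)\<^sup>2 + 4 * (real m + 1) * (real m +
       real (Suc n) * real (block_degree m q (Suc n div m))))"
proof -
  have len: "length q = n" using q by (rule histories_length)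
  let ?D = "\<lambda>x. block_degree m q (x div m)"
  define a where "a = deviation m k q"
  define i where "i y = deviation m k (y # q) - a" for y
  \<comment> \<open>The increment in the ideal case: the parent's vertex is full and the newcomer's
    vertex has degree 0.\<close>
  define c where "c y = of_bool (k = 0) + real m * (of_bool (Suc (?D y) = k) - of_bool (?D y = k)) - limit_degree m k" for y
  define N where "N = real (Suc n)"
  have a: "\<bar>a\<bar> \<le> N" using abs_deviation_le[of m k q] by (simp add: a_def N_def len)
  \<comment> \<open>\<open>i\<close> and \<open>c\<close> can differ only if the parent lies in the
    newcomer's vertex or that vertex has already received an edge. The difference is then at most
    \<open>2 * m + 1\<close>, hence the factor \<open>2 * (m + 1)\<close>.\<close>
  have err: "\<bar>i y - c y\<bar> \<le> 2 * (real m + 1) * (of_bool (y div m = Suc n div m) + real (?D (Suc n)))"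
    if y: "y \<le> n" for y
  proof -
    define s d where "s = real (card {x. x \<le> n \<and> x div m = y div m})"
      and "d = (of_bool (Suc (?D y) = k) - of_bool (?D y = k) :: real)"
    have ie: "i y = of_bool (block_degree m (y # q) (Suc n div m) = k) + s * d - limit_degree m k"
      using members_of_degree_Cons[OF len, of m k y]
      by (simp add: i_def a_def deviation_def s_def d_def len algebra_simps)
    have ce: "c y = of_bool (k = 0) + real m * d - limit_degree m k"
      by (simp add: c_def d_def)
    show ?thesis
    proof (cases "y div m = Suc n div m \<or> 0 < ?D (Suc n)")
      case True
      define u where "u = (of_bool (block_degree m (y # q) (Suc n div m) = k) - of_bool (k = 0) :: real)"
      define v where "v = of_bool (y div m = Suc n div m) + real (?D (Suc n))"
      have v: "1 \<le> v"
        using True by (cases "y div m = Suc n div m") (simp_all add: v_def Suc_le_eq)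
      have u: "\<bar>u\<bar> \<le> 1" by (simp add: u_def)
      have "\<bar>d\<bar> \<le> 1" by (simp add: d_def)
      then have sd: "\<bar>s * d\<bar> \<le> real m * 1" and md: "\<bar>real m * d\<bar> \<le> real m * 1"
        using card_block_le(1)[OF m, of n "y div m"] unfolding abs_mult s_def
        by (intro mult_mono; simp)+
      have "i y - c y = u + (s * d - real m * d)"
        unfolding ie ce u_def by (simp only: diff_diff_eq2 algebra_simps)
      also have "\<bar>u + (s * d - real m * d)\<bar> \<le> \<bar>u\<bar> + (\<bar>s * d\<bar> + \<bar>real m * d\<bar>)"
        by (intro order_trans[OF abs_triangle_ineq] add_left_mono abs_triangle_ineq4)
      also have "\<dots> \<le> 1 + (real m * 1 + real m * 1)"
        by (intro add_mono u sd md)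
      also have "\<dots> \<le> 2 * (real m + 1) * 1"
        by simp
      also have "\<dots> \<le> 2 * (real m + 1) * v"
        using v by (intro mult_left_mono) auto
      finally show ?thesis unfolding v_def .
    next
      case False
      have "y div m \<le> Suc n div m" using y by (intro div_le_mono) simp
      with False have "s = real m" unfolding s_def by (subst card_block_full[OF m]) auto
      moreover have "block_degree m (y # q) (Suc n div m) = 0"
        using False by (simp add: block_degree_Cons)
      ultimately show ?thesis using False by (simp add: ie ce)
    qed
  qed
  \<comment> \<open>Summed over all parents, the balance equation cancels the constants and leaves a
    drift that is linear in the deviations.\<close>
  have csum: "(\<Sum>y\<le>n. c y) = real m * (prev - a)"
  proof -
    have "(\<Sum>y\<le>n. of_bool (Suc (?D y) = k)) = (if k = 0 then 0 else members_of_degree m (k - 1) q)"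
      by (cases k) (simp_all add: members_of_degree_def len)
    then have "(\<Sum>y\<le>n. c y) = N * of_bool (k = 0) +
       real m * ((if k = 0 then 0 else members_of_degree m (k - 1) q) - members_of_degree m k q) - N * limit_degree m k"
      by (simp add: c_def sum.distrib sum_subtractf sum_distrib_left[symmetric] N_def
            members_of_degree_def len algebra_simps)
    also have "\<dots> = real m * (prev - a)"
      unfolding limit_degree_balance[of k m] prev_def a_def deviation_def len N_def
      by (simp add: algebra_simps)
    finally show ?thesis .
  qed
  have "2 * a * (\<Sum>y\<le>n. c y) = real m * (2 * a * prev - 2 * a\<^sup>2)"
    unfolding csum by (simp add: power2_eq_square algebra_simps)
  \<comment> \<open>As \<open>2 * a * prev \<le> a^2 + prev^2\<close>, the restoring term absorbs
    the mixed one, so that \<open>a\<close> itself causes no growth.\<close>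
  also have "\<dots> \<le> real m * prev\<^sup>2"
  proof (rule mult_left_mono)
    show "2 * a * prev - 2 * a\<^sup>2 \<le> prev\<^sup>2"
      using sum_squares_bound[of a prev] zero_le_power2[of a] by linarith
  qed simp
  finally have drift: "2 * a * (\<Sum>y\<le>n. c y) \<le> real m * prev\<^sup>2" .
  have "\<bar>\<Sum>y\<le>n. i y - c y\<bar> \<le> (\<Sum>y\<le>n. 2 * (real m + 1) * (of_bool (y div m = Suc n div m) + real (?D (Suc n))))"
    using err by (intro order_trans[OF sum_abs] sum_mono) auto
  also have "\<dots> = 2 * (real m + 1) * (real (card {x. x \<le> n \<and> x div m = Suc n div m}) + N * real (?D (Suc n)))"
    by (simp add: sum_distrib_left[symmetric] sum.distrib N_def sum_of_bool_atMost)
  also have "\<dots> \<le> 2 * (real m + 1) * (real m + N * real (?D (Suc n)))"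
    using card_block_le(1)[OF m] by (intro mult_left_mono add_right_mono) auto
  finally have e: "\<bar>\<Sum>y\<le>n. i y - c y\<bar> \<le> 2 * (real m + 1) * (real m + N * real (?D (Suc n)))" .
  \<comment> \<open>The crude bound \<open>\<bar>a\<bar> \<le> N\<close> suffices, because the
    degree of the youngest vertex has mean \<open>O(1/n)\<close>.\<close>
  have "2 * a * (\<Sum>y\<le>n. i y - c y) \<le> 2 * (\<bar>a\<bar> * \<bar>\<Sum>y\<le>n. i y - c y\<bar>)"
    unfolding abs_mult[symmetric] by simp
  also have "\<dots> \<le> 2 * (N * (2 * (real m + 1) * (real m + N * real (?D (Suc n)))))"
    using a e by (intro mult_left_mono mult_mono) (auto simp: N_def)
  finally have error: "2 * a * (\<Sum>y\<le>n. i y - c y) \<le> N * (4 * (real m + 1) * (real m + N * real (?D (Suc n))))"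
    by (simp add: algebra_simps)
  have "(\<Sum>y\<le>n. (i y)\<^sup>2) \<le> (\<Sum>y\<le>n. (real m + 2)\<^sup>2)"
    using deviation_Cons_le[OF m, of k _ q]
    by (intro sum_mono) (simp add: i_def a_def abs_le_square_iff[symmetric])
  then have square: "(\<Sum>y\<le>n. (i y)\<^sup>2) \<le> N * (real m + 2)\<^sup>2" by (simp add: N_def)
  have "(\<Sum>y\<le>n. (deviation m k (y # q))\<^sup>2) = (\<Sum>y\<le>n. a\<^sup>2 + 2 * a * c y + 2 * a * (i y - c y) + (i y)\<^sup>2)"
    by (intro sum.cong) (simp_all add: i_def power2_eq_square algebra_simps)
  also have "\<dots> = N * a\<^sup>2 + 2 * a * (\<Sum>y\<le>n. c y) + 2 * a * (\<Sum>y\<le>n. i y - c y) + (\<Sum>y\<le>n. (i y)\<^sup>2)"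
    by (simp only: sum.distrib sum_distrib_left[symmetric]) (simp add: N_def)
  finally show ?thesis
    using drift error square unfolding a_def[symmetric] N_def[symmetric] by (simp add: distrib_left)
qed

text \<open>Induction on \<open>k\<close>: a second moment \<open>B * (n + 1)\<close> at
  \<open>k - 1\<close> enters with the factor \<open>m / (n + 1)\<close>, so the second moment at
  \<open>k\<close> grows by at most a constant per birth.\<close>

lemma mean_square_deviation:
  assumes "0 < m"
  shows "\<exists>C\<ge>0. \<forall>n. history_mean n (\<lambda>q. (deviation m k q)\<^sup>2) \<le> C * real (Suc n)"
proof -
  have step: "\<exists>C\<ge>0. \<forall>n. history_mean n (\<lambda>q. (deviation m k q)\<^sup>2) \<le> C * real (Suc n)"
    if B: "0 \<le> B" and prev: "\<And>n. history_mean n (\<lambda>q. (if k = 0 then 0 else deviation m (k - 1) q)\<^sup>2) \<le> B * real (Suc n)"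
    for k B
  proof -
    \<comment> \<open>The summands come from the deviation at \<open>k - 1\<close>, from the squared
      increment, and from the youngest vertex, where the final square of \<open>m\<close> is the
      bound of \<open>mean_last_block_degree\<close>.\<close>
    define K where "K = real m * B + (real m + 2)\<^sup>2 + 4 * (real m + 1) * (real m + (real m)\<^sup>2)"
    let ?A = "\<lambda>n. history_mean n (\<lambda>q. (deviation m k q)\<^sup>2)"
    have "?A (Suc n) \<le> ?A n + K" for n
    proof -
      define N where "N = real (Suc n)"
      have N: "0 < N" by (simp add: N_def)
      have "?A (Suc n) \<le> history_mean n (\<lambda>q. (deviation m k q)\<^sup>2 +
          (real m / N * (if k = 0 then 0 else deviation m (k - 1) q)\<^sup>2 +
          (((real m + 2)\<^sup>2 + 4 * (real m + 1) * real m) +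
           (4 * (real m + 1)) * (N * real (block_degree m q (Suc n div m))))))"
        unfolding history_mean_Suc
      proof (rule history_mean_mono)
        fix q assume q: "q \<in> histories n"
        show "(\<Sum>y\<le>n. (deviation m k (y # q))\<^sup>2) / real (Suc n) \<le> (deviation m k q)\<^sup>2 +
          (real m / N * (if k = 0 then 0 else deviation m (k - 1) q)\<^sup>2 +
          (((real m + 2)\<^sup>2 + 4 * (real m + 1) * real m) +
           (4 * (real m + 1)) * (N * real (block_degree m q (Suc n div m)))))"
          using divide_right_mono[OF sum_deviation_Cons[OF assms q, of k], of N] N
          by (simp only: N_def[symmetric]) (simp add: add_divide_distrib algebra_simps)
      qed
      also have "\<dots> = ?A n + (real m / N * history_mean n (\<lambda>q. (if k = 0 then 0 else deviation m (k - 1) q)\<^sup>2) +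
          (((real m + 2)\<^sup>2 + 4 * (real m + 1) * real m) +
           (4 * (real m + 1)) * (N * history_mean n (\<lambda>q. real (block_degree m q (Suc n div m))))))"
        by (simp only: history_mean_add history_mean_cmult history_mean_const)
      also have "\<dots> \<le> ?A n + (real m / N * (B * N) +
          (((real m + 2)\<^sup>2 + 4 * (real m + 1) * real m) + (4 * (real m + 1)) * (real m)\<^sup>2))"
        using prev[of n] mean_last_block_degree[OF assms, of n] N unfolding N_def[symmetric]
        by (intro add_mono order_refl mult_left_mono) auto
      also have "\<dots> = ?A n + K"
        using N by (simp add: K_def algebra_simps)
      finally show ?thesis .
    qed
    note A_Suc = this
    have "?A n \<le> ?A 0 + K * real n" for n
    proof (induction n)
      case (Suc n)
      then show ?case using A_Suc[of n] by (simp add: distrib_left)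
    qed simp
    moreover have "?A 0 \<le> 1"
      using abs_deviation_le[of m k "[]"] by (simp add: history_mean_def abs_square_le_1)
    moreover have K: "0 \<le> K" using B by (simp add: K_def)
    ultimately have "?A n \<le> 1 + K * real n" for n
      by (meson add_right_mono order_trans)
    moreover have "1 + K * real n \<le> (1 + K) * real (Suc n)" for n
      using K by (simp add: algebra_simps)
    ultimately have "?A n \<le> (1 + K) * real (Suc n)" for n
      by (meson order_trans)
    then show ?thesis using K by (intro exI[of _ "1 + K"]) auto
  qed
  show ?thesis
  proof (induction k)
    case 0
    show ?case by (rule step[of 0]) (simp_all add: history_mean_const[of _ 0])
  next
    case (Suc k)
    then obtain B where "0 \<le> B" "\<And>n. history_mean n (\<lambda>q. (deviation m k q)\<^sup>2) \<le> B * real (Suc n)"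
      by blast
    then show ?case by (intro step[of B]) simp_all
  qed
qed


text \<open>Chebyshev's inequality for the uniform law. The bound \<open>C / (n + 1)\<close> need
  not be summable over all \<open>n\<close>, but it is along squares.\<close>

lemma deviation_tail:
  assumes "0 < m" "0 < \<epsilon>"
  obtains C where "0 \<le> C" and "\<And>n. real (card {q \<in> histories n. \<epsilon> * real (Suc n) < \<bar>deviation m k q\<bar>}) / fact n
     \<le> C / real (Suc n)"
proof -
  obtain C where C: "0 \<le> C" "\<And>n. history_mean n (\<lambda>q. (deviation m k q)\<^sup>2) \<le> C * real (Suc n)"
    using mean_square_deviation[OF assms(1)] by blast
  have "real (card {q \<in> histories n. \<epsilon> * real (Suc n) < \<bar>deviation m k q\<bar>}) / fact n
     \<le> C / \<epsilon>\<^sup>2 / real (Suc n)" for n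
  proof -
    define N where "N = real (Suc n)"
    have N: "0 < N" by (simp add: N_def)
    have "(\<epsilon> * N)\<^sup>2 * (real (card {q \<in> histories n. \<epsilon> * N < \<bar>deviation m k q\<bar>}) / fact n)
       = history_mean n (\<lambda>q. (\<epsilon> * N)\<^sup>2 * of_bool (\<epsilon> * N < \<bar>deviation m k q\<bar>))"
      unfolding history_mean_cmult
      by (simp add: history_mean_def of_bool_def sum.If_cases Int_def)
    also have "\<dots> \<le> history_mean n (\<lambda>q. (deviation m k q)\<^sup>2)"
    proof (rule history_mean_mono)
      fix q
      have "(\<epsilon> * N)\<^sup>2 \<le> \<bar>deviation m k q\<bar>\<^sup>2" if "\<epsilon> * N < \<bar>deviation m k q\<bar>"
        using that assms(2) N by (intro power_mono) auto
      then show "(\<epsilon> * N)\<^sup>2 * of_bool (\<epsilon> * N < \<bar>deviation m k q\<bar>) \<le> (deviation m k q)\<^sup>2"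
        by (simp add: of_bool_def)
    qed
    also have "\<dots> \<le> C * N" unfolding N_def by (rule C(2))
    finally have "real (card {q \<in> histories n. \<epsilon> * N < \<bar>deviation m k q\<bar>}) / fact n \<le> C * N / (\<epsilon> * N)\<^sup>2"
      using N assms(2) by (subst pos_le_divide_eq) (simp_all only: mult.commute zero_less_power mult_pos_pos)
    also have "\<dots> = C / \<epsilon>\<^sup>2 / N"
      using N by (simp add: power2_eq_square)
    finally show ?thesis unfolding N_def .
  qed
  then show ?thesis using C(1) by (intro that[of "C / \<epsilon>\<^sup>2"]) auto
qed

text \<open>Passing from individuals to vertices only affects the youngest vertex.\<close>

lemma history_fraction_deviation:
  assumes m: "0 < m"
  shows "\<bar>history_fraction m k q - limit_degree m k\<bar>
    \<le> \<bar>deviation m k q\<bar> / real (Suc (length q)) + 2 * real m / real (Suc (length q))"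
proof -
  define n N l where "n = length q" and "N = real (Suc n)" and "l = n div m"
  define X where "X = real (card {b. b \<le> l \<and> block_degree m q b = k})"
  define V where "V = real (Suc l)"
  have X: "X = (\<Sum>b\<le>l. of_bool (block_degree m q b = k))"
    unfolding X_def sum_of_bool_atMost ..
  have "members_of_degree m k q = (\<Sum>x\<le>n. \<Sum>b\<le>l. of_bool (x div m = b) * of_bool (block_degree m q b = k))"
    unfolding members_of_degree_def n_def[symmetric]
  proof (intro sum.cong refl)
    fix x assume "x \<in> {..n}"
    then have "x div m \<le> l" unfolding l_def by (intro div_le_mono) simp
    have "(\<Sum>b\<le>l. of_bool (x div m = b) * of_bool (block_degree m q b = k) :: real)
      = (\<Sum>b\<le>l. if b = x div m then of_bool (block_degree m q (x div m) = k) else 0)"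
      by (intro sum.cong) auto
    then show "of_bool (block_degree m q (x div m) = k) =
        (\<Sum>b\<le>l. of_bool (x div m = b) * of_bool (block_degree m q b = k) :: real)"
      using \<open>x div m \<le> l\<close> by simp
  qed
  also have "\<dots> = (\<Sum>b\<le>l. real (card {x. x \<le> n \<and> x div m = b}) * of_bool (block_degree m q b = k))"
    by (subst sum.swap) (simp only: sum_distrib_right[symmetric] sum_of_bool_atMost)
  finally have W: "members_of_degree m k q =
      (\<Sum>b\<le>l. real (card {x. x \<le> n \<and> x div m = b}) * of_bool (block_degree m q b = k))" .
  have full: "card {x. x \<le> n \<and> x div m = b} = m" if "b < l" for b
  proof (rule card_block_full[OF m])
    show "b < Suc n div m"
      using that div_le_mono[of n "Suc n" m] unfolding l_def by linarith
  qed
  \<comment> \<open>All vertices but the last are full, so giving each the weight \<open>m\<close>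
    miscounts at most \<open>m\<close> individuals.\<close>
  have "real m * X - members_of_degree m k q =
      (\<Sum>b\<le>l. (real m - real (card {x. x \<le> n \<and> x div m = b})) * of_bool (block_degree m q b = k))"
    unfolding W X sum_distrib_left left_diff_distrib sum_subtractf ..
  also have "\<dots> = (\<Sum>b\<in>{l}. (real m - real (card {x. x \<le> n \<and> x div m = b})) * of_bool (block_degree m q b = k))"
    using full by (intro sum.mono_neutral_right) auto
  finally have mX: "\<bar>real m * X - members_of_degree m k q\<bar> \<le> real m"
    using card_block_le(1)[OF m, of n l] by (simp add: of_bool_def)
  have "n < m * l + m" "m * l \<le> n"
    using mult_div_mod_eq[of m n] mod_less_divisor[OF m, of n] unfolding l_def by linarith+
  then have "Suc n \<le> m * Suc l" "m * Suc l \<le> Suc n + m" by simp_all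
  then have mV: "N \<le> real m * V" "real m * V \<le> N + real m"
    unfolding N_def V_def of_nat_mult[symmetric] of_nat_add[symmetric] of_nat_le_iff by simp_all
  have V: "0 < V" and N: "0 < N" by (simp_all add: V_def N_def)
  define p where "p = limit_degree m k"
  have "p * (real m * V - N) \<le> 1 * real m"
    using limit_degree_bounds[of m k, folded p_def] mV by (intro mult_mono) linarith+
  moreover have "0 \<le> p * (real m * V - N)"
    using limit_degree_bounds[of m k, folded p_def] mV by (intro mult_nonneg_nonneg) linarith+
  \<comment> \<open>One \<open>m\<close> comes from the last vertex in the numerator, the other from
    rounding \<open>N\<close> up to \<open>m * V\<close>.\<close>
  ultimately have "\<bar>real m * (X - p * V)\<bar> \<le> \<bar>deviation m k q\<bar> + 2 * real m"
    using mX unfolding deviation_def p_def[symmetric] n_def[symmetric] N_def[symmetric]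
    unfolding right_diff_distrib mult.left_commute[of "real m" p V] by linarith
  then have "\<bar>real m * (X - p * V)\<bar> / (real m * V) \<le> (\<bar>deviation m k q\<bar> + 2 * real m) / (real m * V)"
    using V by (intro divide_right_mono) auto
  moreover have "X / V - p = real m * (X - p * V) / (real m * V)"
    using V m by (simp add: field_simps)
  ultimately have "\<bar>X / V - p\<bar> \<le> (\<bar>deviation m k q\<bar> + 2 * real m) / (real m * V)"
    using V by (simp only: abs_divide abs_mult[of "real m" V] abs_of_pos abs_of_nat)
  also have "\<dots> \<le> (\<bar>deviation m k q\<bar> + 2 * real m) / N"
    using mV N by (intro divide_left_mono) auto
  finally show ?thesis
    by (simp add: history_fraction_def X_def V_def l_def n_def p_def N_def add_divide_distrib)
qed


section \<open>Convergence of the degree distribution\<close>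

text \<open>Between \<open>l^2\<close> and the next square there are \<open>2 * l\<close> further
  indices, so bounded steps change \<open>d\<close> by \<open>O(l)\<close> there, which is
  negligible against \<open>l^2\<close>.\<close>

lemma tendsto_zero_along_squares:
  fixes d :: "nat \<Rightarrow> real"
  assumes step: "\<And>n. \<bar>d (Suc n) - d n\<bar> \<le> K"
    and sq: "\<And>\<epsilon>. 0 < \<epsilon> \<Longrightarrow> eventually (\<lambda>l. \<bar>d (l\<^sup>2)\<bar> \<le> \<epsilon> * real (Suc (l\<^sup>2))) sequentially"
  shows "(\<lambda>n. d n / real (Suc n)) \<longlonglongrightarrow> 0"
proof (rule LIMSEQ_I)
  fix r :: real assume r: "0 < r"
  have K: "0 \<le> K" using step[of 0] by linarith
  have near: "\<bar>d (a + i) - d a\<bar> \<le> K * real i" for a i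
  proof (induction i)
    case (Suc i)
    then show ?case using step[of "a + i"] by (simp add: algebra_simps)
  qed simp
  obtain L where L: "\<And>l. L \<le> l \<Longrightarrow> \<bar>d (l\<^sup>2)\<bar> \<le> r / 2 * real (Suc (l\<^sup>2))"
    using sq[of "r / 2"] r by (auto simp: eventually_sequentially)
  \<comment> \<open>For \<open>l \<ge> L'\<close> the change \<open>2 * K * l\<close> within a gap
    stays below \<open>r / 2 * l^2\<close>.\<close>
  obtain L' :: nat where L': "4 * K / r < real L'" using reals_Archimedean2 by blast
  have "norm (d n / real (Suc n) - 0) < r" if n: "(Suc (L + L'))\<^sup>2 \<le> n" for n
  proof -
    define l where "l = floor_sqrt n"
    have l: "Suc (L + L') \<le> l" using n by (simp add: l_def le_floor_sqrtI)
    have "l\<^sup>2 \<le> n" by (simp add: l_def)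
    then obtain i where i: "n = l\<^sup>2 + i" using le_Suc_ex by blast
    have "n < (Suc l)\<^sup>2" unfolding l_def by (rule Suc_floor_sqrt_power2_gt)
    then have "i \<le> 2 * l" by (simp add: i power2_eq_square)
    then have i2: "real i \<le> 2 * real l" by linarith
    define S where "S = real (l\<^sup>2)"
    have S: "S = real l * real l" "real (Suc n) = S + real i + 1"
      by (simp_all add: S_def power2_eq_square i)
    have lK: "4 * K < r * real l"
    proof -
      have "4 * K < r * real L'" using L' r by (simp add: pos_divide_less_eq mult.commute)
      also have "\<dots> \<le> r * real l" using l r by (intro mult_left_mono) auto
      finally show ?thesis .
    qed
    have "\<bar>d n - d (l\<^sup>2)\<bar> \<le> K * real i"
      unfolding i by (rule near)
    also have "\<dots> \<le> K * (2 * real l)"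
      using i2 K by (rule mult_left_mono)
    finally have 1: "\<bar>d n - d (l\<^sup>2)\<bar> \<le> 2 * K * real l" by (simp add: mult_ac)
    have 2: "\<bar>d (l\<^sup>2)\<bar> \<le> r / 2 * (S + 1)"
      using L[of l] l by (simp add: S_def add.commute)
    have "(4 * K) * real l < (r * real l) * real l"
      using lK l by (intro mult_strict_right_mono) auto
    then have 3: "2 * K * real l < r / 2 * S"
      by (simp add: S(1))
    have "r / 2 * (S + 1) + r / 2 * S \<le> r * real (Suc n)"
      using r unfolding S(2) by (simp add: distrib_left)
    then have "\<bar>d n\<bar> < r * real (Suc n)"
      using 1 2 3 by linarith
    then show ?thesis
      by (simp only: diff_zero real_norm_def abs_divide abs_of_nat pos_divide_less_eq of_nat_0_less_iff zero_less_Suc)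
  qed
  then show "\<exists>no. \<forall>n\<ge>no. norm (d n / real (Suc n) - 0) < r" by blast
qed

context unit_birth_clocks
begin

lemma measurable_ex_follows:
  "finite Q \<Longrightarrow> {w\<in>space M. \<exists>q\<in>Q. follows (path w) q} \<in> events"
  by (rule sets.sets_Collect_finite_Ex) auto

lemma AE_deviation:
  assumes m: "0 < m"
  shows "AE w in M. (\<lambda>n. deviation m k (history (path w) n) / real (Suc n)) \<longlonglongrightarrow> 0"
proof -
  have ae: "AE w in M. eventually (\<lambda>l. \<forall>q\<in>histories (l\<^sup>2). follows (path w) q \<longrightarrow>
      \<bar>deviation m k q\<bar> \<le> \<epsilon> * real (Suc (l\<^sup>2))) sequentially" if \<epsilon>: "0 < \<epsilon>" for \<epsilon>
  proof -
    define Q where "Q l = {q \<in> histories (l\<^sup>2). \<epsilon> * real (Suc (l\<^sup>2)) < \<bar>deviation m k q\<bar>}" for l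
    define A where "A l = {w\<in>space M. \<exists>q\<in>Q l. follows (path w) q}" for l
    have Q: "Q l \<subseteq> histories (l\<^sup>2)" for l by (auto simp: Q_def)
    have A: "A l \<in> events" for l
      unfolding A_def using finite_subset[OF Q finite_histories] by (rule measurable_ex_follows)
    obtain C where C: "0 \<le> C" "\<And>n. real (card {q \<in> histories n. \<epsilon> * real (Suc n) < \<bar>deviation m k q\<bar>}) / fact n
       \<le> C / real (Suc n)"
      using deviation_tail[OF m \<epsilon>] by blast
    have le: "prob (A l) \<le> C * inverse (real l ^ 2)" if "1 \<le> l" for l
    proof -
      have "prob (A l) \<le> C / real (Suc (l\<^sup>2))"
        using C(2)[of "l\<^sup>2"] prob_follows_set[OF Q] by (simp add: A_def Q_def)
      also have "\<dots> \<le> C / real (l\<^sup>2)"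
        using C(1) that by (intro frac_le) auto
      finally show ?thesis by (simp add: divide_inverse)
    qed
    have "summable (\<lambda>l. C * inverse (real l ^ 2))"
      by (intro summable_mult inverse_power_summable) simp
    then have "summable (\<lambda>l. prob (A l))"
    proof (rule summable_comparison_test'[of _ 1])
      fix l :: nat assume "1 \<le> l"
      then show "norm (prob (A l)) \<le> C * inverse (real l ^ 2)"
        using le[of l] by (simp only: real_norm_def abs_of_nonneg measure_nonneg)
    qed
    then have "AE w in M. eventually (\<lambda>l. w \<in> space M - A l) sequentially"
      by (intro borel_cantelli_AE1 A) (simp_all add: less_top[symmetric])
    then show ?thesis
      by eventually_elim (auto elim!: eventually_mono simp: A_def Q_def not_less)
  qed
  \<comment> \<open>Countably many tolerances, so that one null set serves all of them.\<close>
  have "AE w in M. \<forall>i::nat. eventually (\<lambda>l. \<forall>q\<in>histories (l\<^sup>2). follows (path w) q \<longrightarrow>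
      \<bar>deviation m k q\<bar> \<le> 1 / real (Suc i) * real (Suc (l\<^sup>2))) sequentially"
    unfolding AE_all_countable by (intro allI ae) simp
  then show ?thesis using AE_regular
  proof eventually_elim
    case (elim w)
    note reg = elim(2)
    show ?case
    proof (rule tendsto_zero_along_squares)
      fix n
      obtain y where "history (path w) (Suc n) = y # history (path w) n"
        using history_Suc[OF reg] by blast
      then show "\<bar>deviation m k (history (path w) (Suc n)) - deviation m k (history (path w) n)\<bar> \<le> real m + 2"
        using deviation_Cons_le[OF m] by simp
    next
      fix \<epsilon> :: real assume "0 < \<epsilon>"
      then obtain i where i: "1 / real (Suc i) < \<epsilon>"
        using nat_approx_posE by blast
      have "eventually (\<lambda>l. \<forall>q\<in>histories (l\<^sup>2). follows (path w) q \<longrightarrow>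
          \<bar>deviation m k q\<bar> \<le> 1 / real (Suc i) * real (Suc (l\<^sup>2))) sequentially"
        using elim(1) by blast
      then show "eventually (\<lambda>l. \<bar>deviation m k (history (path w) (l\<^sup>2))\<bar> \<le> \<epsilon> * real (Suc (l\<^sup>2))) sequentially"
      proof eventually_elim
        case (elim l)
        then have "\<bar>deviation m k (history (path w) (l\<^sup>2))\<bar> \<le> 1 / real (Suc i) * real (Suc (l\<^sup>2))"
          using history_props[OF reg] by blast
        also have "\<dots> \<le> \<epsilon> * real (Suc (l\<^sup>2))"
          using i by (intro mult_right_mono) auto
        finally show ?case .
      qed
    qed
  qed
qed

lemma AE_history_fraction:
  assumes m: "0 < m"
  shows "AE w in M. (\<lambda>n. history_fraction m k (history (path w) n)) \<longlonglongrightarrow> limit_degree m k"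
  using AE_deviation[OF m, of k] AE_regular
proof eventually_elim
  case (elim w)
  have "(\<lambda>n. \<bar>deviation m k (history (path w) n) / real (Suc n)\<bar> + 2 * real m / real (Suc n)) \<longlonglongrightarrow> \<bar>0\<bar> + 0"
    by (intro tendsto_add tendsto_rabs elim(1) LIMSEQ_Suc[OF lim_const_over_n])
  then have lim: "(\<lambda>n. \<bar>deviation m k (history (path w) n) / real (Suc n)\<bar> + 2 * real m / real (Suc n)) \<longlonglongrightarrow> 0"
    by simp
  have "norm (history_fraction m k (history (path w) n) - limit_degree m k) \<le>
      \<bar>deviation m k (history (path w) n) / real (Suc n)\<bar> + 2 * real m / real (Suc n)" for n
    using history_fraction_deviation[OF m, of k "history (path w) n"]
    by (simp only: real_norm_def abs_divide abs_of_nat length_history[OF elim(2)])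
  then have "(\<lambda>n. history_fraction m k (history (path w) n) - limit_degree m k) \<longlonglongrightarrow> 0"
    using lim by (intro Lim_null_comparison[OF _ lim] always_eventually allI)
  then show ?case by (rule LIM_zero_cancel)
qed

section \<open>Transfer to convergence in probability\<close>

text \<open>The union over all \<open>n \<ge> N\<close> is taken because the index reached at time
  \<open>t\<close> is random; phrased by histories it is a countable union of measurable
  events.\<close>

definition late_error :: "nat \<Rightarrow> nat \<Rightarrow> real \<Rightarrow> nat \<Rightarrow> 'a set" where
  "late_error m k \<epsilon> N = {w\<in>space M. \<exists>n\<in>{N..}. \<exists>q\<in>{q\<in>histories n. \<epsilon> < \<bar>history_fraction m k q - limit_degree m k\<bar>}.
     follows (path w) q}"

lemma sets_late_error [measurable]: "late_error m k \<epsilon> N \<in> events"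
  unfolding late_error_def by (intro sets.sets_Collect_countable_Ex' measurable_ex_follows) auto

lemma late_errorI:
  assumes "regular (path w)" "w \<in> space M" "N \<le> n"
    and "\<epsilon> < \<bar>history_fraction m k (history (path w) n) - limit_degree m k\<bar>"
  shows "w \<in> late_error m k \<epsilon> N"
  using assms history_props[OF assms(1), of n] by (auto simp: late_error_def)

text \<open>The events decrease in \<open>N\<close>, and almost sure convergence makes their
  intersection null.\<close>

lemma prob_late_error_tendsto:
  assumes "0 < m" "0 < \<epsilon>"
  shows "(\<lambda>N. prob (late_error m k \<epsilon> N)) \<longlonglongrightarrow> 0"
proof -
  have "(\<lambda>N. prob (late_error m k \<epsilon> N)) \<longlonglongrightarrow> prob (\<Inter>N. late_error m k \<epsilon> N)"
    by (rule finite_Lim_measure_decseq) (auto simp: decseq_def late_error_def)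
  moreover have "AE w in M. w \<notin> (\<Inter>N. late_error m k \<epsilon> N)"
    using AE_history_fraction[OF assms(1), of k]
  proof eventually_elim
    case (elim w)
    obtain N where N: "\<And>n. N \<le> n \<Longrightarrow> \<bar>history_fraction m k (history (path w) n) - limit_degree m k\<bar> < \<epsilon>"
      using LIMSEQ_D[OF elim assms(2)] by auto
    have "w \<notin> late_error m k \<epsilon> N"
      using N by (fastforce simp: late_error_def dest: history_eqI)
    then show ?case by blast
  qed
  then have "prob (\<Inter>N. late_error m k \<epsilon> N) = 0"
    by (intro measure_eq_0_null_sets) (auto simp: AE_iff_null_sets)
  ultimately show ?thesis by simp
qed

lemma prob_born_late_tendsto:
  "(\<lambda>T. prob {w\<in>space M. \<exists>q\<in>histories N. follows (path w) q \<and> real T < birth_time (path w) (people q ! N)}) \<longlonglongrightarrow> 0"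
proof -
  define B where "B T = {w\<in>space M. \<exists>q\<in>histories N. follows (path w) q \<and> real T < birth_time (path w) (people q ! N)}"
    for T :: nat
  have B: "B T \<in> events" for T
    unfolding B_def by (rule sets.sets_Collect_finite_Ex) auto
  have "(\<lambda>T. prob (B T)) \<longlonglongrightarrow> prob (\<Inter>T. B T)"
  proof (rule finite_Lim_measure_decseq)
    have "B T' \<subseteq> B T" if "T \<le> T'" for T T'
    proof -
      have "real T < x" if "real T' < x" for x using that \<open>T \<le> T'\<close> by linarith
      then show ?thesis unfolding B_def by blast
    qed
    then show "decseq B" by (simp add: decseq_def)
  qed (use B in blast)
  moreover have "(\<Inter>T. B T) = {}"
  proof (rule equals0I)
    fix w
    assume w: "w \<in> (\<Inter>T. B T)"
    \<comment> \<open>A bound on the birth time that is uniform over the finitely many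
      histories.\<close>
    define t where "t = Max ((\<lambda>q. birth_time (path w) (people q ! N)) ` histories N)"
    obtain T :: nat where T: "t < real T" using reals_Archimedean2 by blast
    from w obtain q where "q \<in> histories N" "real T < birth_time (path w) (people q ! N)"
      by (auto simp: B_def)
    moreover from this have "birth_time (path w) (people q ! N) \<le> t"
      unfolding t_def by (intro Max_ge) auto
    ultimately show False using T by simp
  qed
  ultimately show ?thesis unfolding B_def[symmetric] by (simp only: measure_empty)
qed

text \<open>\<open>N\<close> is chosen first, to make late errors rare, then \<open>T\<close>, to
  make it unlikely that individual \<open>N + 1\<close> is unborn at time \<open>T\<close>. From
  then on an error is, up to a null set, one or the other.\<close>

lemma degree_fraction_in_probability:
  assumes m: "0 < m"
  shows "tendsto_in_prob M (\<lambda>t w. degree_fraction m (path w) k t) (limit_degree m k) at_top"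
  unfolding tendsto_in_prob_def
proof (intro allI impI)
  fix \<epsilon> :: real assume \<epsilon>: "0 < \<epsilon>"
  let ?A = "\<lambda>t. {w \<in> space M. \<epsilon> < \<bar>degree_fraction m (path w) k t - limit_degree m k\<bar>}"
  let ?B = "\<lambda>N T. {w\<in>space M. \<exists>q\<in>histories N. follows (path w) q \<and> real T < birth_time (path w) (people q ! N)}"
  show "((\<lambda>t. prob (?A t)) \<longlongrightarrow> 0) at_top"
  proof (rule tendstoI)
    fix \<delta> :: real assume \<delta>: "0 < \<delta>"
    obtain N where N: "prob (late_error m k \<epsilon> N) < \<delta> / 2"
      using order_tendstoD(2)[OF prob_late_error_tendsto[OF m \<epsilon>, of k], of "\<delta> / 2"] \<delta>
      by (auto simp: eventually_sequentially)
    obtain T where T: "prob (?B N T) < \<delta> / 2"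
      using order_tendstoD(2)[OF prob_born_late_tendsto, of "\<delta> / 2" N] \<delta>
      by (auto simp: eventually_sequentially)
    have BT: "?B N T \<in> events" by (rule sets.sets_Collect_finite_Ex) auto
    have "prob (?A t) < \<delta>" if t: "real T \<le> t" for t
    proof -
      \<comment> \<open>\<open>?A t\<close> need not be known to be measurable, as non-measurable sets have measure 0.\<close>
      have "prob (?A t) \<le> prob (late_error m k \<epsilon> N \<union> ?B N T)"
      proof (rule finite_measure_mono_AE)
        show "AE w in M. w \<in> ?A t \<longrightarrow> w \<in> late_error m k \<epsilon> N \<union> ?B N T"
          using AE_regular
        proof (eventually_elim, intro impI)
          fix w assume reg: "regular (path w)" and w: "w \<in> ?A t"
          show "w \<in> late_error m k \<epsilon> N \<union> ?B N T"
          proof (cases "tau (path w) (Suc N) \<le> t")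
            case True
            then obtain n where "N \<le> n" "tau (path w) (Suc n) \<le> t" "t < tau (path w) (Suc (Suc n))"
              by (rule history_at_time[OF reg])
            then show ?thesis
              using w late_errorI[OF reg, of N n \<epsilon> m k] degree_fraction_history[OF reg m, of n t k] by auto
          next
            case False
            then show ?thesis
              using w t tau_history[OF reg order_refl, of N] history_props[OF reg, of N] by force
          qed
        qed
      qed (use BT in auto)
      also have "\<dots> \<le> prob (late_error m k \<epsilon> N) + prob (?B N T)"
        using BT by (intro measure_Un_le) auto
      finally show ?thesis using N T by simp
    qed
    then show "eventually (\<lambda>t. dist (prob (?A t)) 0 < \<delta>) at_top"
      unfolding eventually_at_top_linorder by (intro exI[of _ "real T"]) simp
  qed
qed

text \<open>The index is deterministic here: the label \<open>(n, j)\<close> is at least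
  \<open>n\<close>, so the late errors from \<open>n - 1\<close> on cover the event.\<close>

lemma degree_fraction_in_probability_discrete:
  assumes m: "0 < m" and j: "1 \<le> j"
  shows "tendsto_in_prob M (\<lambda>n w. degree_fraction m (path w) k (tau (path w) (idx m n j)))
     (limit_degree m k) sequentially"
  unfolding tendsto_in_prob_def
proof (intro allI impI)
  fix \<epsilon> :: real assume \<epsilon>: "0 < \<epsilon>"
  let ?A = "\<lambda>n. {w \<in> space M.
     \<epsilon> < \<bar>degree_fraction m (path w) k (tau (path w) (idx m n j)) - limit_degree m k\<bar>}"
  have "prob (?A n) \<le> prob (late_error m k \<epsilon> (n - 1))" for n
  proof (rule finite_measure_mono_AE)
    obtain l where l: "idx m n j = Suc l" "n - 1 \<le> l"
    proof
      show "idx m n j = Suc (m * (n - 1) + (j - 1))" using j by (simp add: idx_def)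
      have "1 * (n - 1) \<le> m * (n - 1)" using m by (intro mult_right_mono) auto
      then show "n - 1 \<le> m * (n - 1) + (j - 1)" by linarith
    qed
    show "AE w in M. w \<in> ?A n \<longrightarrow> w \<in> late_error m k \<epsilon> (n - 1)"
      using AE_regular
    proof (eventually_elim, intro impI)
      fix w assume reg: "regular (path w)" and w: "w \<in> ?A n"
      have "tau (path w) (Suc l) < tau (path w) (Suc (Suc l))"
        using strict_mono_tau[OF reg] by (simp add: strict_mono_Suc_iff)
      then show "w \<in> late_error m k \<epsilon> (n - 1)"
        using w late_errorI[OF reg _ l(2), of \<epsilon> m k] degree_fraction_history[OF reg m order_refl, of l k]
        by (auto simp: l(1))
    qed
  qed simp
  moreover have "(\<lambda>n. prob (late_error m k \<epsilon> (n - 1))) \<longlonglongrightarrow> 0"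
    by (rule LIMSEQ_imp_Suc) (simp add: prob_late_error_tendsto[OF m \<epsilon>])
  ultimately show "(\<lambda>n. prob (?A n)) \<longlonglongrightarrow> 0"
    by (intro tendsto_sandwich[of "\<lambda>_. 0" "\<lambda>n. prob (?A n)" _ "\<lambda>n. prob (late_error m k \<epsilon> (n - 1))"]) auto
qed

end


section \<open>Transition probabilities\<close>

context unit_birth_clocks
begin

text \<open>Ancestries are countable, so the quantifiers in \<open>is_arg_min\<close> and the
  \<open>LEAST\<close> preserve measurability. The statements are proved together because each set
  is built from the preceding choice.\<close>

lemma measurable_first_born: "Measurable.pred M (\<lambda>w. u \<in> first_born (path w) x)"
  and measurable_next_born: "(\<lambda>w. next_born (path w) (first_born (path w) x)) \<in> M \<rightarrow>\<^sub>M count_space UNIV"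
proof -
  have next_born: "(\<lambda>w. next_born (path w) (A w)) \<in> M \<rightarrow>\<^sub>M count_space UNIV"
    if [measurable]: "\<And>u. Measurable.pred M (\<lambda>w. u \<in> A w)" for A
  proof -
    have "(\<lambda>w. LEAST i. is_arg_min (birth_time (path w)) (\<lambda>u. u \<notin> A w) (from_nat i)) \<in> M \<rightarrow>\<^sub>M count_space UNIV"
      unfolding is_arg_min_def by measurable
    then show ?thesis
      unfolding next_born_def by (rule measurable_compose) simp
  qed
  have fb: "Measurable.pred M (\<lambda>w. u \<in> first_born (path w) x)" for u
  proof (induction x arbitrary: u)
    case (Suc x)
    note [measurable] = Suc.IH next_born[of "\<lambda>w. first_born (path w) x", OF Suc.IH]
    show ?case by simp
  qed simp
  show "Measurable.pred M (\<lambda>w. u \<in> first_born (path w) x)" by (rule fb)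
  show "(\<lambda>w. next_born (path w) (first_born (path w) x)) \<in> M \<rightarrow>\<^sub>M count_space UNIV"
    by (rule next_born[OF fb])
qed

lemma measurable_individual [measurable]: "(\<lambda>w. individual (path w) x) \<in> M \<rightarrow>\<^sub>M count_space UNIV"
  unfolding individual_def by (rule measurable_next_born)

lemma measurable_tau [measurable]: "(\<lambda>w. tau (path w) x) \<in> borel_measurable M"
  unfolding tau_def by (rule measurable_compose_countable[OF measurable_birth_time measurable_individual])

lemma measurable_edge_event [measurable]: "Measurable.pred M (\<lambda>w. edge_event m (path w) n j i)"
  unfolding edge_event_def is_parent_def by measurable

lemma measurable_CBP: "(\<lambda>w. CBP m (path w) (tau (path w) x)) \<in> M \<rightarrow>\<^sub>M multigraph_algebra"
  unfolding multigraph_algebra_def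
proof (rule measurable_measure_of)
  let ?G = "\<lambda>w. CBP m (path w) (tau (path w) x)"
  fix Y :: "multigraph set"
  assume "Y \<in> (\<Union>n. {{G. n \<in> vertices G}}) \<union> (\<Union>x y k. {{G. edge_count G x y = k}})"
  then consider n where "Y = {G. n \<in> vertices G}" | a b k where "Y = {G. edge_count G a b = k}"
    by auto
  then show "?G -` Y \<inter> space M \<in> events"
  proof cases
    case (1 n)
    have "{w \<in> space M. 1 \<le> n \<and> tau (path w) (idx m n 1) \<le> tau (path w) x} \<in> events"
      by measurable
    then show ?thesis
      by (simp add: 1 CBP_def vimage_def Int_def conj_commute)
  next
    case (2 a b k)
    have "Measurable.pred M (\<lambda>w. card {j \<in> {1..m}. tau (path w) (idx m a j) \<le> tau (path w) x \<and> edge_event m (path w) a j b} = k)"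
      by measurable
    then have "{w \<in> space M. (if 1 \<le> a \<and> 1 \<le> b
        then card {j \<in> {1..m}. tau (path w) (idx m a j) \<le> tau (path w) x \<and> edge_event m (path w) a j b} else 0) = k} \<in> events"
      by (cases "1 \<le> a \<and> 1 \<le> b") simp_all
    also have "{w \<in> space M. (if 1 \<le> a \<and> 1 \<le> b
        then card {j \<in> {1..m}. tau (path w) (idx m a j) \<le> tau (path w) x \<and> edge_event m (path w) a j b} else 0) = k}
      = ?G -` Y \<inter> space M"
      by (auto simp: 2 CBP_def)
    finally show ?thesis .
  qed
qed auto

text \<open>The parent of the next individual is the head \<open>y\<close> of the longer history,
  and vertex \<open>i\<close> consists of the indices with quotient \<open>i - 1\<close> by
  \<open>m\<close>.\<close>

lemma edge_event_history:
  assumes reg: "regular e" and m: "0 < m" and idx: "idx m v j = Suc n" and i: "1 \<le> i"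
    and y: "history e (Suc n) = y # history e n"
  shows "edge_event m e v (j + 1) i \<longleftrightarrow> y div m = i - 1"
proof -
  have "idx m v (j + 1) = Suc (Suc n)" using idx by (simp add: idx_def)
  moreover have "is_parent e (idx m i l) (Suc (Suc n)) \<longleftrightarrow> y = m * (i - 1) + (l - 1)" if "1 \<le> l" for l
  proof -
    have "idx m i l = Suc (m * (i - 1) + (l - 1))" using that by (simp add: idx_def)
    then show ?thesis using is_parent_history[OF reg, of "Suc n" "Suc n"] by (auto simp: y)
  qed
  ultimately have "edge_event m e v (j + 1) i \<longleftrightarrow> (\<exists>l\<in>{1..m}. y = m * (i - 1) + (l - 1))"
    by (auto simp: edge_event_def)
  also have "\<dots> \<longleftrightarrow> y div m = i - 1"
  proof
    assume "\<exists>l\<in>{1..m}. y = m * (i - 1) + (l - 1)"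
    then obtain l where l: "1 \<le> l" "l \<le> m" "y = m * (i - 1) + (l - 1)" by auto
    then have "l - 1 < m" by linarith
    then show "y div m = i - 1" by (simp add: l(3))
  next
    assume "y div m = i - 1"
    then have "y = m * (i - 1) + (Suc (y mod m) - 1)" using mult_div_mod_eq[of m y] by simp
    moreover have "Suc (y mod m) \<in> {1..m}" using m by (simp add: Suc_le_eq)
    ultimately show "\<exists>l\<in>{1..m}. y = m * (i - 1) + (l - 1)" by blast
  qed
  finally show ?thesis .
qed

text \<open>The uniform law at length \<open>n + 1\<close> factorises: the next parent is uniform
  and independent of the history so far.\<close>

lemma prob_next_parent:
  assumes "Q \<subseteq> histories n" "Y \<subseteq> {..n}"
  shows "prob {w\<in>space M. \<exists>q\<in>(\<lambda>(y, q). y # q) ` (Y \<times> Q). follows (path w) q} =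
     real (card Y) / real (Suc n) * prob {w\<in>space M. \<exists>q\<in>Q. follows (path w) q}"
proof -
  have card: "card ((\<lambda>(y, q). y # q) ` (Y \<times> Q)) = card Y * card Q"
    by (subst card_image) (auto simp: inj_on_def card_cartesian_product)
  have sub: "(\<lambda>(y, q). y # q) ` (Y \<times> Q) \<subseteq> histories (Suc n)"
    using assms by auto
  show ?thesis
    unfolding prob_follows_set[OF sub] prob_follows_set[OF assms(1)] card by simp
qed

text \<open>Since the graph is a function of the history, every event of the generated sigma-algebra
  says, up to a null set, that the history lies in some \<open>Q\<close>. The next parent is
  independent of such events.\<close>

lemma edge_conditional_probability:
  assumes m: "0 < m" and idx: "idx m v j = Suc n" and i: "1 \<le> i"
  shows "AE w in M. real_cond_exp M (generated_by M (\<lambda>w. CBP m (path w) (tau (path w) (Suc n))))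
      (indicator {w \<in> space M. edge_event m (path w) v (j + 1) i}) w
    = real (card {y. y \<le> n \<and> y div m = i - 1}) / real (Suc n)"
proof -
  let ?G = "\<lambda>w. CBP m (path w) (tau (path w) (Suc n))"
  define B where "B = {w \<in> space M. edge_event m (path w) v (j + 1) i}"
  define Y where "Y = {y. y \<le> n \<and> y div m = i - 1}"
  have G: "?G \<in> M \<rightarrow>\<^sub>M multigraph_algebra" by (rule measurable_CBP)
  have space: "?G \<in> space M \<rightarrow> space multigraph_algebra"
    using measurable_space[OF G] by auto
  have sets: "sets (generated_by M ?G) = {?G -` X \<inter> space M |X. X \<in> sets multigraph_algebra}"
    unfolding generated_by_def by (rule sets_vimage_algebra2[OF space])
  have sub: "subalgebra M (generated_by M ?G)"
    using measurable_sets[OF G] unfolding subalgebra_def sets by (auto simp: generated_by_def)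
  interpret F: finite_measure_subalgebra M "generated_by M ?G"
    by unfold_locales (rule sub)
  have B: "B \<in> events" unfolding B_def by measurable
  have main: "prob (A \<inter> B) = real (card Y) / real (Suc n) * prob A"
    if A: "A \<in> sets (generated_by M ?G)" for A
  proof -
    obtain X where X: "A = ?G -` X \<inter> space M" using A unfolding sets by blast
    have "A \<in> events" using A sub by (auto simp: subalgebra_def)
    define Q where "Q = {q \<in> histories n. history_graph m q \<in> X}"
    have Q: "Q \<subseteq> histories n" "finite Q" "Y \<subseteq> {..n}" "finite Y"
      by (auto simp: Q_def Y_def)
    have eqA: "prob A = prob {w\<in>space M. \<exists>q\<in>Q. follows (path w) q}"
    proof (rule finite_measure_eq_AE)
      show "AE w in M. w \<in> A \<longleftrightarrow> w \<in> {w\<in>space M. \<exists>q\<in>Q. follows (path w) q}"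
        using AE_regular
      proof (eventually_elim)
        case (elim w)
        have "(\<exists>q\<in>Q. follows (path w) q) \<longleftrightarrow> history_graph m (history (path w) n) \<in> X"
          using history_props[OF elim, of n] by (auto simp: Q_def dest: history_eqI)
        then show ?case using CBP_history[OF elim m, of n] by (auto simp: X)
      qed
    qed (use \<open>A \<in> events\<close> measurable_ex_follows[OF Q(2)] in auto)
    have "prob (A \<inter> B) = prob {w\<in>space M. \<exists>q\<in>(\<lambda>(y, q). y # q) ` (Y \<times> Q). follows (path w) q}"
    proof (rule finite_measure_eq_AE)
      show "AE w in M. w \<in> A \<inter> B \<longleftrightarrow> w \<in> {w\<in>space M. \<exists>q\<in>(\<lambda>(y, q). y # q) ` (Y \<times> Q). follows (path w) q}"
        using AE_regular
      proof (eventually_elim)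
        case (elim w)
        obtain y where y: "y \<le> n" "history (path w) (Suc n) = y # history (path w) n"
          using history_Suc[OF elim] by blast
        have "(\<exists>q\<in>(\<lambda>(y, q). y # q) ` (Y \<times> Q). follows (path w) q) \<longleftrightarrow>
            history (path w) (Suc n) \<in> (\<lambda>(y, q). y # q) ` (Y \<times> Q)"
        proof
          assume "\<exists>q\<in>(\<lambda>(y, q). y # q) ` (Y \<times> Q). follows (path w) q"
          then obtain q where q: "q \<in> (\<lambda>(y, q). y # q) ` (Y \<times> Q)" "follows (path w) q" by blast
          moreover have "q \<in> histories (Suc n)" using q(1) Q by auto
          ultimately show "history (path w) (Suc n) \<in> (\<lambda>(y, q). y # q) ` (Y \<times> Q)"
            using history_eqI by metis
        qed (use history_props[OF elim, of "Suc n"] in blast)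
        also have "\<dots> \<longleftrightarrow> y \<in> Y \<and> history (path w) n \<in> Q"
          unfolding y(2) by auto
        also have "\<dots> \<longleftrightarrow> edge_event m (path w) v (j + 1) i \<and> history_graph m (history (path w) n) \<in> X"
          using history_props[OF elim, of n] edge_event_history[OF elim m idx i y(2)] y(1)
          by (auto simp: Q_def Y_def)
        finally show ?case using CBP_history[OF elim m, of n] by (auto simp: X B_def)
      qed
    qed (use \<open>A \<in> events\<close> B Q measurable_ex_follows[of "(\<lambda>(y, q). y # q) ` (Y \<times> Q)"] in auto)
    also have "\<dots> = real (card Y) / real (Suc n) * prob A"
      unfolding eqA by (rule prob_next_parent[OF Q(1,3)])
    finally show ?thesis .
  qed
  have "AE w in M. real_cond_exp M (generated_by M ?G) (indicator B) w = real (card Y) / real (Suc n)"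
  proof (rule F.real_cond_exp_charact)
    fix A assume A: "A \<in> sets (generated_by M ?G)"
    then have [measurable]: "A \<in> events" using sub by (auto simp: subalgebra_def)
    have "set_lebesgue_integral M A (indicator B) = prob (A \<inter> B)"
      using B by (simp add: set_lebesgue_integral_def indicator_inter_arith[symmetric])
    moreover have "(LINT w:A|M. real (card Y) / real (Suc n)) = real (card Y) / real (Suc n) * prob A"
      by (simp add: set_lebesgue_integral_def)
    ultimately show "set_lebesgue_integral M A (indicator B) = (LINT w:A|M. real (card Y) / real (Suc n))"
      using main[OF A] by simp
  qed (use B in \<open>auto simp: less_top[symmetric]\<close>)
  then show ?thesis by (simp add: B_def Y_def)
qed

end

text \<open>These are the present members of the vertex that the next individual joins, the possible
  targets of a loop apart from the newcomer; they give the \<open>j\<close> in the loop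
  probability.\<close>

lemma card_last_block:
  assumes "0 < m"
  shows "card {y. y \<le> n \<and> y div m = Suc n div m} = Suc n mod m"
proof -
  let ?b = "Suc n div m"
  have n: "Suc n = m * ?b + Suc n mod m" by simp
  have r: "Suc n mod m < m" using assms by simp
  have "y \<le> n \<and> y div m = ?b \<longleftrightarrow> m * ?b \<le> y \<and> y < m * ?b + Suc n mod m" for y
  proof
    assume "m * ?b \<le> y \<and> y < m * ?b + Suc n mod m"
    then obtain d where d: "y = m * ?b + d" "d < Suc n mod m" by (metis add_less_cancel_left le_iff_add)
    then have "d < m" using r by linarith
    then have "y div m = ?b" unfolding d(1) by simp
    moreover have "y \<le> n" using d n by linarith
    ultimately show "y \<le> n \<and> y div m = ?b" by blast
  next
    assume y: "y \<le> n \<and> y div m = ?b"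
    have "y = m * (y div m) + y mod m" by simp
    then have "m * ?b \<le> y" using y by (metis le_add1)
    moreover have "y < m * ?b + Suc n mod m" using y n by linarith
    ultimately show "m * ?b \<le> y \<and> y < m * ?b + Suc n mod m" ..
  qed
  then have "{y. y \<le> n \<and> y div m = ?b} = {m * ?b..<m * ?b + Suc n mod m}"
    unfolding set_eq_iff mem_Collect_eq atLeastLessThan_iff by blast
  then show ?thesis by (simp only: card_atLeastLessThan diff_add_inverse)
qed

theorem corollary1p6:
  fixes M :: "'a measure" and E :: "nat list \<Rightarrow> nat \<Rightarrow> 'a \<Rightarrow> real"
    and m :: nat and e :: "'a \<Rightarrow> nat list \<Rightarrow> nat \<Rightarrow> real" and p :: "nat \<Rightarrow> real"
  assumes "2 \<le> m"
    and "birth_clocks M (\<lambda>k. 1) E"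
  defines "e \<equiv> \<lambda>w u k. E u k w"
    and "p \<equiv> \<lambda>k. 1 / (real m + 1) * (1 + 1 / real m) powi (- int k)"
  shows "(\<forall>n j i. j \<le> m - 1 \<longrightarrow> 1 \<le> i \<longrightarrow> i \<le> n \<longrightarrow> 1 \<le> idx m n j \<longrightarrow>
            (AE w in M.
               real_cond_exp M (generated_by M (\<lambda>w. CBP m (e w) (tau (e w) (idx m n j))))
                 (indicator {w \<in> space M. edge_event m (e w) n (j + 1) i}) w
               = (if i \<noteq> n then 1 / ((real n - 1) + real j / real m)
                  else (real j / real m) / ((real n - 1) + real j / real m))))
       \<and> (\<forall>k. tendsto_in_prob M (\<lambda>t w. degree_fraction m (e w) k t) (p k) at_top)
       \<and> (\<forall>k. \<forall>j\<in>{1..m}.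
            tendsto_in_prob M (\<lambda>n w. degree_fraction m (e w) k (tau (e w) (idx m n j)))
              (p k) sequentially)"
proof -
  interpret birth_clocks M "\<lambda>k. 1" E by fact
  interpret unit_birth_clocks M E ..
  have m: "0 < m" using assms(1) by simp
  have p: "p k = limit_degree m k" for k
  proof -
    have "1 + 1 / real m = (real m + 1) / real m" using m by (simp add: field_simps)
    then show ?thesis
      by (simp add: p_def limit_degree_def power_int_minus power_divide inverse_eq_divide)
  qed
  have "AE w in M.
      real_cond_exp M (generated_by M (\<lambda>w. CBP m (e w) (tau (e w) (idx m v j))))
        (indicator {w \<in> space M. edge_event m (e w) v (j + 1) i}) w
      = (if i \<noteq> v then 1 / ((real v - 1) + real j / real m)
         else (real j / real m) / ((real v - 1) + real j / real m))"
    if j: "j \<le> m - 1" and i: "1 \<le> i" "i \<le> v" and pos: "1 \<le> idx m v j" for v j i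
  proof -
    obtain n where n: "idx m v j = Suc n" using pos by (cases "idx m v j") auto
    have jm: "j < m" using j m by linarith
    have Sn: "Suc n = m * (v - 1) + j" using n by (simp add: idx_def)
    \<comment> \<open>Of vertex \<open>v\<close> exactly \<open>j\<close> individuals are present.
      The bound \<open>j < m\<close> fixes quotient and remainder, also for \<open>j = 0\<close>,
      when \<open>v\<close> is still empty.\<close>
    then have dm: "Suc n div m = v - 1" "Suc n mod m = j" using jm by simp_all
    have "real (Suc n) = real m * (real v - 1) + real j"
      unfolding Sn using i by (simp add: of_nat_diff)
    also have "\<dots> = real m * ((real v - 1) + real j / real m)"
      using m by (simp add: distrib_left)
    finally have N: "real (Suc n) = real m * ((real v - 1) + real j / real m)" .
    have "real (card {y. y \<le> n \<and> y div m = i - 1}) / real (Suc n)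
      = (if i \<noteq> v then 1 / ((real v - 1) + real j / real m)
         else (real j / real m) / ((real v - 1) + real j / real m))"
    proof (cases "i = v")
      case True
      then have "card {y. y \<le> n \<and> y div m = i - 1} = j"
        using card_last_block[OF m, of n] by (simp only: dm)
      then show ?thesis using True m unfolding N by simp
    next
      case False
      \<comment> \<open>An older vertex is complete and has probability \<open>m / (n + 1)\<close>;
        cancelling \<open>m\<close> gives the stated form.\<close>
      then have "i - 1 < Suc n div m" using i unfolding dm by linarith
      then have "card {y. y \<le> n \<and> y div m = i - 1} = m"
        by (rule card_block_full[OF m])
      then show ?thesis using False m unfolding N by simp
    qed
    then show ?thesis
      using edge_conditional_probability[OF m n i(1)] unfolding e_def n by simp
  qed
  moreover have "tendsto_in_prob M (\<lambda>t w. degree_fraction m (e w) k t) (p k) at_top" for k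
    unfolding e_def p by (rule degree_fraction_in_probability[OF m])
  moreover have "tendsto_in_prob M (\<lambda>n w. degree_fraction m (e w) k (tau (e w) (idx m n j))) (p k) sequentially"
    if "j \<in> {1..m}" for k j
    unfolding e_def p using that by (intro degree_fraction_in_probability_discrete[OF m]) simp
  ultimately show ?thesis by blast
qed

end
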